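(* There exists an absolute constant $C>0$ such that the following holds. Let $m\ge 1$ be an integer, and let $$p(t)=\sum_{j=1}^m c_j e^{\lambda_j t},\qquad c_j,\lambda_j\in\mathbb C,$$ be an exponential polynomial of order at most $m$. Let $I\subset\mathbb R$ be a bounded interval, and let $E\subset I$ be measurable with $|E|>0$. If $p\equiv0$ the conclusion is trivial (both sides vanish); otherwise, putting $$M_{\Re}=\max_{\lambda\in\operatorname{spec}p}|\operatorname{Re}\lambda|,$$ one has $$\sup_I|p|\le \exp(|I|M_{\Re})\left(\frac{C|I|}{|E|}\right)^{m-1}\operatorname*{ess\,sup}_E|p|.$$
   Context: A reduced exponential polynomial is a finite sum $p(t)=\sum_{\lambda\in\Lambda}c_\lambda e^{\lambda t}$ with all $c_\lambda\neq0$ and the exponents $\lambda\in\Lambda\subset\mathbb C$ distinct; any exponential polynomial is brought to this form by combining equal exponents and deleting zero coefficients. Then $\operatorname{spec}p=\Lambda$ and $\operatorname{ord}p=|\Lambda|$ (the order); for the zero polynomial, $\operatorname{spec}(0)=\varnothing$ and $\operatorname{ord}(0)=0$. $|\cdot|$ applied to a subset of $\mathbb R$ denotes Lebesgue measure. "Absolute constant" means independent of all other data in the statement. *)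

theory Defs
  imports "HOL-Analysis.Analysis" "HOL-Probability.Essential_Supremum"
begin

text \<open>Exponential polynomials are functions of a real variable with complex exponents. As the
  exponents are collected in a set, they are automatically distinct.\<close>

definition reduced_exp_poly ::
    "complex set \<Rightarrow> (complex \<Rightarrow> complex) \<Rightarrow> (real \<Rightarrow> complex) \<Rightarrow> bool" where
  "reduced_exp_poly L a p \<longleftrightarrow>
     finite L \<and> (\<forall>\<mu>\<in>L. a \<mu> \<noteq> 0) \<and> p = (\<lambda>t. \<Sum>\<mu>\<in>L. a \<mu> * exp (\<mu> * of_real t))"

definition is_exp_poly :: "(real \<Rightarrow> complex) \<Rightarrow> bool" where
  "is_exp_poly p \<longleftrightarrow> (\<exists>L a. reduced_exp_poly L a p)"

text \<open>The set of exponents of the reduced form depends only on the function \<open>p\<close>; see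
  \<open>exp_spec_eq\<close> below. For the zero function it is empty.\<close>

definition exp_spec :: "(real \<Rightarrow> complex) \<Rightarrow> complex set" where
  "exp_spec p = (THE L. \<exists>a. reduced_exp_poly L a p)"

definition exp_order :: "(real \<Rightarrow> complex) \<Rightarrow> nat" where
  "exp_order p = card (exp_spec p)"

lemma exponentials_independent:
  fixes b :: "complex \<Rightarrow> complex"
  assumes "finite L" "\<And>t::real. (\<Sum>\<mu>\<in>L. b \<mu> * exp (\<mu> * of_real t)) = 0"
  shows "\<forall>\<mu>\<in>L. b \<mu> = 0"
  using assms
proof (induction L arbitrary: b rule: finite_induct)
  case empty
  then show ?case by simp
next
  case (insert \<nu> L)
  have shift: "b \<nu> + (\<Sum>\<mu>\<in>L. b \<mu> * exp ((\<mu> - \<nu>) * of_real t)) = 0" for t :: real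
  proof -
    have "b \<nu> + (\<Sum>\<mu>\<in>L. b \<mu> * exp ((\<mu> - \<nu>) * of_real t))
        = exp (- \<nu> * of_real t) * (\<Sum>\<mu>\<in>insert \<nu> L. b \<mu> * exp (\<mu> * of_real t))"
      using insert.hyps
      by (simp add: sum_distrib_left distrib_left mult_exp_exp algebra_simps)
    then show ?thesis using insert.prems by simp
  qed
  have "(\<Sum>\<mu>\<in>L. (b \<mu> * (\<mu> - \<nu>)) * exp (\<mu> * of_real t)) = 0" for t :: real
  proof -
    let ?D = "\<Sum>\<mu>\<in>L. b \<mu> * ((\<mu> - \<nu>) * exp ((\<mu> - \<nu>) * of_real t))"
    have "((\<lambda>s::real. b \<nu> + (\<Sum>\<mu>\<in>L. b \<mu> * exp ((\<mu> - \<nu>) * of_real s)))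
        has_vector_derivative ?D) (at t)"
      by (auto intro!: derivative_eq_intros has_vector_derivative_real_field simp: mult_ac)
    moreover have "((\<lambda>s::real. b \<nu> + (\<Sum>\<mu>\<in>L. b \<mu> * exp ((\<mu> - \<nu>) * of_real s)))
        has_vector_derivative 0) (at t)"
      by (simp add: shift)
    ultimately have "?D = 0"
      by (rule vector_derivative_unique_at)
    then have "exp (\<nu> * of_real t) * ?D = 0" by simp
    moreover have "exp (\<nu> * of_real t) * ?D
        = (\<Sum>\<mu>\<in>L. (b \<mu> * (\<mu> - \<nu>)) * exp (\<mu> * of_real t))"
      unfolding sum_distrib_left
      by (intro sum.cong refl) (simp add: left_diff_distrib exp_diff)
    ultimately show ?thesis by simp
  qed
  then have "\<forall>\<mu>\<in>L. b \<mu> * (\<mu> - \<nu>) = 0"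
    by (rule insert.IH)
  then have L: "\<forall>\<mu>\<in>L. b \<mu> = 0"
    using insert.hyps by auto
  then have "b \<nu> = 0"
    using shift[of 0] by simp
  with L show ?case by simp
qed

lemma reduced_exp_poly_unique:
  assumes "reduced_exp_poly L a p" "reduced_exp_poly L' a' p"
  shows "L = L'"
proof -
  define x where "x \<mu> = (if \<mu> \<in> L then a \<mu> else 0)" for \<mu>
  define y where "y \<mu> = (if \<mu> \<in> L' then a' \<mu> else 0)" for \<mu>
  have fin: "finite L" "finite L'"
    using assms by (auto simp: reduced_exp_poly_def)
  have px: "p t = (\<Sum>\<mu>\<in>L \<union> L'. x \<mu> * exp (\<mu> * of_real t))" for t
  proof -
    have "p t = (\<Sum>\<mu>\<in>L. x \<mu> * exp (\<mu> * of_real t))"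
      using assms(1) by (simp add: reduced_exp_poly_def x_def)
    also have "\<dots> = (\<Sum>\<mu>\<in>L \<union> L'. x \<mu> * exp (\<mu> * of_real t))"
      using fin by (intro sum.mono_neutral_left) (auto simp: x_def)
    finally show ?thesis .
  qed
  have py: "p t = (\<Sum>\<mu>\<in>L \<union> L'. y \<mu> * exp (\<mu> * of_real t))" for t
  proof -
    have "p t = (\<Sum>\<mu>\<in>L'. y \<mu> * exp (\<mu> * of_real t))"
      using assms(2) by (simp add: reduced_exp_poly_def y_def)
    also have "\<dots> = (\<Sum>\<mu>\<in>L \<union> L'. y \<mu> * exp (\<mu> * of_real t))"
      using fin by (intro sum.mono_neutral_left) (auto simp: y_def)
    finally show ?thesis .
  qed
  have "(\<Sum>\<mu>\<in>L \<union> L'. (x \<mu> - y \<mu>) * exp (\<mu> * of_real t)) = 0" for t :: real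
    using px[of t] py[of t] by (simp add: left_diff_distrib sum_subtractf)
  then have eq: "\<forall>\<mu>\<in>L \<union> L'. x \<mu> - y \<mu> = 0"
    using fin by (intro exponentials_independent) auto
  have nz: "\<And>\<mu>. \<mu> \<in> L \<Longrightarrow> a \<mu> \<noteq> 0" "\<And>\<mu>. \<mu> \<in> L' \<Longrightarrow> a' \<mu> \<noteq> 0"
    using assms by (auto simp: reduced_exp_poly_def)
  show ?thesis
  proof (intro set_eqI iffI)
    fix \<mu> assume "\<mu> \<in> L"
    then show "\<mu> \<in> L'" using eq[rule_format, of \<mu>] nz(1)[of \<mu>]
      by (auto simp: x_def y_def split: if_splits)
  next
    fix \<mu> assume "\<mu> \<in> L'"
    then show "\<mu> \<in> L" using eq[rule_format, of \<mu>] nz(2)[of \<mu>]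
      by (auto simp: x_def y_def split: if_splits)
  qed
qed

lemma exp_spec_eq: "reduced_exp_poly L a p \<Longrightarrow> exp_spec p = L"
  unfolding exp_spec_def by (rule the_equality) (use reduced_exp_poly_unique in blast)+

lemma exp_spec_zero [simp]: "exp_spec (\<lambda>t. 0) = {}"
  by (rule exp_spec_eq[of _ "\<lambda>_. 1"]) (simp add: reduced_exp_poly_def)

text \<open>Combining equal exponents and deleting zero coefficients.\<close>

lemma reduced_exp_poly_sum:
  fixes c l :: "nat \<Rightarrow> complex" and m :: nat
  defines "a \<equiv> (\<lambda>\<mu>. \<Sum>j | j \<in> {1..m} \<and> l j = \<mu>. c j)"
  shows "reduced_exp_poly {\<mu> \<in> l ` {1..m}. a \<mu> \<noteq> 0} a
           (\<lambda>t. \<Sum>j=1..m. c j * exp (l j * of_real t))"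
proof -
  have "(\<Sum>j=1..m. c j * exp (l j * of_real t))
      = (\<Sum>\<mu>\<in>{\<mu> \<in> l ` {1..m}. a \<mu> \<noteq> 0}. a \<mu> * exp (\<mu> * of_real t))" for t :: real
  proof -
    have "(\<Sum>j=1..m. c j * exp (l j * of_real t))
        = (\<Sum>\<mu>\<in>l ` {1..m}. \<Sum>j | j \<in> {1..m} \<and> l j = \<mu>. c j * exp (l j * of_real t))"
      by (rule sum.image_gen) simp
    also have "\<dots> = (\<Sum>\<mu>\<in>l ` {1..m}. a \<mu> * exp (\<mu> * of_real t))"
      unfolding a_def sum_distrib_right by (intro sum.cong) auto
    also have "\<dots> = (\<Sum>\<mu>\<in>{\<mu> \<in> l ` {1..m}. a \<mu> \<noteq> 0}. a \<mu> * exp (\<mu> * of_real t))"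
      by (intro sum.mono_neutral_right) auto
    finally show ?thesis .
  qed
  then show ?thesis
    by (auto simp: reduced_exp_poly_def)
qed

lemma
  fixes c l :: "nat \<Rightarrow> complex"
  shows is_exp_poly_sum: "is_exp_poly (\<lambda>t. \<Sum>j=1..m. c j * exp (l j * of_real t))"
    and exp_order_sum_le: "exp_order (\<lambda>t. \<Sum>j=1..m. c j * exp (l j * of_real t)) \<le> m"
proof -
  show "is_exp_poly (\<lambda>t. \<Sum>j=1..m. c j * exp (l j * of_real t))"
    unfolding is_exp_poly_def using reduced_exp_poly_sum by blast
  have "card {\<mu> \<in> l ` {1..m}. P \<mu>} \<le> m" for P
  proof -
    have "card {\<mu> \<in> l ` {1..m}. P \<mu>} \<le> card (l ` {1..m})"
      by (rule card_mono) auto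
    also have "\<dots> \<le> m" using card_image_le[of "{1..m}" l] by simp
    finally show ?thesis .
  qed
  then show "exp_order (\<lambda>t. \<Sum>j=1..m. c j * exp (l j * of_real t)) \<le> m"
    unfolding exp_order_def exp_spec_eq[OF reduced_exp_poly_sum] .
qed

end

theory Submission
  imports Defs "HOL-Complex_Analysis.Complex_Analysis"
begin

text \<open>
  Normalise \<open>I\<close> to \<open>[0, 1]\<close>. For an exponential polynomial \<open>p\<close> of order \<open>n\<close>, an exponent \<open>\<nu>\<close> of \<open>p\<close>
  and \<open>\<Delta>\<close> the largest distance of \<open>\<nu>\<close> to an exponent, \<open>p e\<^sup>-\<^sup>\<nu>\<^sup>t\<close> has doubling constant \<open>exp (O(n + \<Delta>))\<close> on
  discs, so \<open>(p' - \<nu> p) / p\<close> is a sum of \<open>O(n + \<Delta>)\<close> simple poles plus an error \<open>O(n + \<Delta>)\<close>. By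
  Kolmogorov's inequality the ratio has weak type norm \<open>O(n + \<Delta>)\<close>, whatever \<open>E\<close> is.

  Remove the exponents one at a time by \<open>p \<mapsto> p' - \<nu> p\<close>. As long as the diameter \<open>\<Delta>\<close> of the remaining
  spectrum exceeds \<open>n\<close>, one of its two endpoints \<open>\<nu>\<close> satisfies \<open>sup |p' - \<nu> p| \<ge> (\<Delta> / 2) sup |p|\<close>, because the
  two derivatives differ by \<open>\<Delta> |p|\<close> in modulus; this compensates the loss \<open>O(\<Delta>)\<close> in the ratio. Once
  \<open>\<Delta> \<le> n\<close>, variation of constants at a point \<open>t\<^sub>0\<close> bounds \<open>sup |p|\<close> by the product of the ratios at \<open>t\<^sub>0\<close>,
  and the iterated integrals compensate the losses \<open>O(n)\<close>; the factor \<open>exp M\<close> enters only here. Altogether \<open>sup |p|\<close> is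
  at most \<open>e\<^sup>M C\<^sup>n\<^sup>-\<^sup>1 |p(t\<^sub>0)|\<close> times \<open>n - 1\<close> factors \<open>1 + f(t\<^sub>0)\<close> with \<open>\<integral>\<^sub>E f\<^sup>1\<^sup>/\<^sup>2 = O(|E|\<^sup>1\<^sup>/\<^sup>2)\<close>.
  Averaging \<open>f\<^sup>1\<^sup>/\<^sup>2\<close> over \<open>E\<close> and the inequality of the means give a point \<open>t\<^sub>0\<close> of \<open>E\<close> where the product
  is at most \<open>(C / |E|)\<^sup>n\<^sup>-\<^sup>1\<close>.
\<close>

section \<open>Kolmogorov's inequality for sums of simple poles\<close>

lemma borel_measurable_lebesgueI:
  "f \<in> borel_measurable borel \<Longrightarrow> f \<in> borel_measurable lebesgue"
  by (simp add: measurable_completion)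

text \<open>On the right half plane \<open>Re (w / csqrt (w + T))\<close> is comparable to \<open>sqrt |w|\<close> where \<open>|w| > T\<close>, while
  \<open>w / csqrt (w + T)\<close> is at most linear in \<open>w\<close>. This holomorphic majorant carries the
  weak type bound: with \<open>T = N / |E|\<close> one obtains the factor \<open>sqrt |E|\<close>.\<close>

lemma csqrt_quotient_bounds:
  fixes w :: complex and T :: real
  assumes "Re w \<ge> 0" "T > 0"
  defines "G \<equiv> w / csqrt (w + of_real T)"
  shows "0 \<le> Re G" "cmod G \<le> cmod w / sqrt T"
    "sqrt (cmod w) \<le> sqrt (2 * T) + 2 * sqrt 2 * Re G"
proof -
  define v where "v = csqrt (w + of_real T)"
  have v2: "v\<^sup>2 = w + of_real T" by (simp add: v_def)
  have Rev: "Re v \<ge> 0" using csqrt_principal[of "w + of_real T"] by (auto simp: v_def)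
  have nv: "(cmod v)\<^sup>2 = cmod (w + of_real T)"
    by (metis norm_power v2)
  have le: "Re w + T \<le> (cmod v)\<^sup>2"
    unfolding nv using complex_Re_le_cmod[of "w + of_real T"] by simp
  then have T_le: "T \<le> (cmod v)\<^sup>2" using assms by simp
  have v0: "v \<noteq> 0" using T_le assms by auto
  \<comment> \<open>Since \<open>v\<close> is a principal root of a number with nonnegative real
    part, it lies in the sector of half angle pi/4 about the positive axis, where |v| is at most
    sqrt 2 times Re v.\<close>
  have "Re (v\<^sup>2) = Re w + T" using v2 by simp
  then have "(Re v)\<^sup>2 - (Im v)\<^sup>2 \<ge> 0" using assms by (simp add: power2_eq_square)
  then have "(cmod v)\<^sup>2 \<le> 2 * (Re v)\<^sup>2" by (simp add: cmod_power2)
  then have Rev2: "cmod v \<le> sqrt 2 * Re v"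
    using Rev by (intro power2_le_imp_le[of "cmod v" "sqrt 2 * Re v"]) (simp_all add: power_mult_distrib)
  \<comment> \<open>This form makes the sign visible: the real part becomes Re v times 1 - T/|v|^2,
    and |v|^2 is at least Re w + T, hence at least T.\<close>
  have "G = v - of_real T / v"
    using v0 v2 by (simp add: G_def v_def[symmetric] field_simps power2_eq_square)
  moreover have "Re (of_real T / v) = T * Re v / (cmod v)\<^sup>2"
    by (simp add: Re_divide cmod_power2)
  ultimately have ReG: "Re G = Re v * (1 - T / (cmod v)\<^sup>2)"
    by (simp add: right_diff_distrib)
  show G0: "0 \<le> Re G"
    unfolding ReG using Rev T_le v0 by (intro mult_nonneg_nonneg) (auto simp: field_simps)
  have "sqrt T \<le> cmod v"
    using T_le real_le_lsqrt real_sqrt_le_iff by (metis norm_ge_zero real_sqrt_abs abs_of_nonneg)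
  then show "cmod G \<le> cmod w / sqrt T"
    unfolding G_def v_def[symmetric] norm_divide using assms v0 by (intro divide_left_mono) auto
  have "(Re w)\<^sup>2 \<le> (Re w + T)\<^sup>2"
    using assms by (intro power_mono) auto
  then have "cmod w \<le> (cmod v)\<^sup>2"
    unfolding nv by (simp add: cmod_def)
  then have w: "sqrt (cmod w) \<le> cmod v" by (simp add: real_le_lsqrt)
  \<comment> \<open>For |v|^2 up to 2T the first term suffices. Beyond that the factor 1 - T/|v|^2
    is at least 1/2, so the second term dominates sqrt 2 times Re v.\<close>
  have "cmod v \<le> sqrt (2 * T) + 2 * sqrt 2 * Re G"
  proof (cases "(cmod v)\<^sup>2 \<le> 2 * T")
    case True
    then have "cmod v \<le> sqrt (2 * T)" by (simp add: real_le_rsqrt)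
    then show ?thesis using G0 by (smt (verit) mult_nonneg_nonneg real_sqrt_ge_zero)
  next
    case False
    then have "1 / 2 \<le> 1 - T / (cmod v)\<^sup>2" using v0 by (simp add: field_simps)
    then have "Re v * (1/2) \<le> Re G" unfolding ReG using Rev by (intro mult_left_mono) auto
    then have "sqrt 2 * Re v \<le> 2 * sqrt 2 * Re G" by simp
    then show ?thesis using Rev2 assms by (smt (verit) real_sqrt_ge_zero)
  qed
  with w show "sqrt (cmod w) \<le> sqrt (2 * T) + 2 * sqrt 2 * Re G" by linarith
qed

text \<open>Cauchy's theorem on the half disc over \<open>[-1, 2]\<close> with kernel \<open>(z + 1) (2 - z)\<close>, which has modulus
  \<open>3 Im z\<close> on the half circle and so cancels the singularity of \<open>K / Im z\<close>.\<close>

lemma half_disc_integral_bound: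
  fixes G :: "complex \<Rightarrow> complex"
  assumes hol: "G holomorphic_on {z. Im z > - e}" and "e > 0"
    and bound: "\<And>z. Im z > 0 \<Longrightarrow> cmod (G z) \<le> K / Im z"
    and pos: "\<And>x::real. Re (G x) \<ge> 0"
  shows "(\<integral>\<^sup>+x\<in>{0..1}. ennreal (Re (G (of_real x))) \<partial>lebesgue) \<le> ennreal (9 * pi / 4 * K)"
proof -
  define S where "S = {z. Im z > - e}"
  define H where "H z = G z * ((z + 1) * (2 - z))" for z
  define g1 where "g1 = linepath (-1::complex) 2"
  define g2 where "g2 = part_circlepath (1/2) (3/2) 0 pi"
  have K0: "0 \<le> K"
    using bound[of \<i>] by (smt (verit) div_by_1 imaginary_unit.simps(2) norm_ge_zero)
  have arc: "cmod (H z) \<le> 3 * K" "0 \<le> Im z" if "z \<in> path_image g2" for z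
  proof -
    from that obtain x where x: "0 \<le> x" "x \<le> pi" and z: "z = 1/2 + 3/2 * exp (\<i> * of_real x)"
      by (auto simp: g2_def path_image_part_circlepath)
    have z': "Re z = 1/2 + 3/2 * cos x" "Im z = 3/2 * sin x"
      by (simp_all add: z Re_exp Im_exp)
    show im: "0 \<le> Im z" using x by (simp add: z' sin_ge_zero)
    \<comment> \<open>By Thales, the triangle with vertices -1, 2 and z has a right angle at z. The
      product of its legs is therefore the hypotenuse 3 times the height Im z.\<close>
    have "(cmod ((z + 1) * (2 - z)))\<^sup>2 = (3 * Im z)\<^sup>2"
    proof -
      have s: "(sin x)\<^sup>2 = 1 - (cos x)\<^sup>2" by (rule sin_squared_eq)
      have a: "(cmod (z + 1))\<^sup>2 = 9/2 * (1 + cos x)"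
        unfolding cmod_power2 plus_complex.sel minus_complex.sel z' by (simp, use s in algebra)
      have b: "(cmod (2 - z))\<^sup>2 = 9/2 * (1 - cos x)"
        unfolding cmod_power2 plus_complex.sel minus_complex.sel z' by (simp, use s in algebra)
      show ?thesis
        unfolding norm_mult power_mult_distrib[of "cmod (z + 1)"] a b z' using s by algebra
    qed
    then have k: "cmod ((z + 1) * (2 - z)) = 3 * Im z"
      using im by (simp only: power2_eq_iff_nonneg norm_ge_zero mult_nonneg_nonneg)
    show "cmod (H z) \<le> 3 * K"
    proof (cases "Im z = 0")
      case True
      then have "cmod ((z + 1) * (2 - z)) = 0" using k by simp
      then show ?thesis using K0 by (metis H_def mult_nonneg_nonneg mult_zero_right norm_mult zero_le_numeral)
    next
      case False
      then have "cmod (G z) * (3 * Im z) \<le> K / Im z * (3 * Im z)"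
        using bound[of z] im by (intro mult_right_mono) auto
      then show ?thesis using False k by (simp add: H_def norm_mult mult.assoc)
    qed
  qed
  have holH: "H holomorphic_on S"
    unfolding H_def S_def by (intro holomorphic_intros hol)
  have "open S" unfolding S_def by (simp add: open_halfspace_Im_gt)
  have "convex S" unfolding S_def by (simp add: convex_halfspace_Im_gt)
  have p1: "path_image g1 \<subseteq> S"
    using \<open>convex S\<close> \<open>e > 0\<close> unfolding g1_def path_image_linepath
    by (intro closed_segment_subset) (auto simp: S_def)
  have p2: "path_image g2 \<subseteq> S"
    using arc(2) \<open>e > 0\<close> by (force simp: S_def)
  have ends: "pathfinish g1 = pathstart g2" "pathfinish g2 = pathstart g1"
    by (simp_all add: g1_def g2_def exp_pi_i')
  have int2: "H contour_integrable_on g2" and int1: "H contour_integrable_on g1"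
    using contour_integrable_holomorphic_simple[OF holH \<open>open S\<close> _ p1]
      contour_integrable_holomorphic_simple[OF holH \<open>open S\<close> _ p2]
    by (auto simp: g1_def g2_def)
  have "(H has_contour_integral 0) (g1 +++ g2)"
    using ends p1 p2 holH \<open>convex S\<close>
    by (intro Cauchy_theorem_convex_simple[where S=S])
       (auto simp: g1_def g2_def valid_path_join path_image_join)
  then have "contour_integral g1 H + contour_integral g2 H = 0"
    using int1 int2 by (metis contour_integral_join contour_integral_unique g1_def g2_def valid_path_linepath valid_path_part_circlepath)
  \<comment> \<open>The half circle of radius 3/2 has length 3 pi/2, and the integrand is at most 3K
    on it.\<close>
  moreover have "cmod (contour_integral g2 H) \<le> 3 * K * (3/2) * (pi - 0)"
    using int2 arc(1) K0 unfolding g2_def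
    by (intro has_contour_integral_bound_part_circlepath[where f=H and z="1/2"]) (auto intro: has_contour_integral_integral)
  ultimately have J: "cmod (contour_integral g1 H) \<le> 9 * pi / 2 * K"
    by (simp add: eq_neg_iff_add_eq_0[symmetric] algebra_simps)
  have "((\<lambda>x. H (of_real x)) has_integral contour_integral g1 H) {-1..2}"
    using has_contour_integral_linepath_Reals_iff[of "-1" 2 H "contour_integral g1 H"]
      has_contour_integral_integral[OF int1] by (simp add: g1_def)
  then have "((\<lambda>x. Re (H (of_real x))) has_integral Re (contour_integral g1 H)) {-1..2}"
    using has_integral_Re by blast
  moreover have ReH: "Re (H (of_real x)) = Re (G (of_real x)) * ((x + 1) * (2 - x))" for x
  proof -
    have "H (of_real x) = of_real ((x + 1) * (2 - x)) * G (of_real x)"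
      by (simp add: H_def mult.commute)
    then show ?thesis by (simp only: times_complex.sel Re_complex_of_real Im_complex_of_real) (simp add: mult.commute)
  qed
  ultimately have HI: "((\<lambda>x. Re (G (of_real x)) * ((x + 1) * (2 - x))) has_integral Re (contour_integral g1 H)) {-1..2}"
    by simp
  have "(\<integral>\<^sup>+x. ennreal (indicator {-1..2} x * (Re (G (of_real x)) * ((x + 1) * (2 - x)))) \<partial>lebesgue)
      = ennreal (Re (contour_integral g1 H))"
    unfolding nn_integral_completion
    using pos by (intro nn_integral_has_integral_lebesgue[OF _ HI]) auto
  also have "\<dots> \<le> ennreal (9 * pi / 2 * K)"
    using J complex_Re_le_cmod[of "contour_integral g1 H"] by (intro ennreal_leI) linarith
  finally have le: "(\<integral>\<^sup>+x. ennreal (indicator {-1..2} x * (Re (G (of_real x)) * ((x + 1) * (2 - x)))) \<partial>lebesgue)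
      \<le> ennreal (9 * pi / 2 * K)" .
  \<comment> \<open>On [0, 1] the kernel is at least 2, which halves the constant; on the rest of
    [-1, 2] the integrand is nonnegative and may be dropped.\<close>
  have "ennreal (Re (G (of_real x))) * indicator {0..1} x
     \<le> ennreal (1/2) * ennreal (indicator {-1..2} x * (Re (G (of_real x)) * ((x + 1) * (2 - x))))" for x :: real
  proof (cases "x \<in> {0..1}")
    case True
    then have "0 \<le> x * (1 - x)" by auto
    then have "2 \<le> (x + 1) * (2 - x)" by (simp add: algebra_simps)
    then have "Re (G (of_real x)) * 2 \<le> Re (G (of_real x)) * ((x + 1) * (2 - x))"
      using pos by (intro mult_left_mono) auto
    then show ?thesis using True pos[of x]
      by (subst ennreal_mult''[symmetric]) (auto intro!: ennreal_leI)
  qed auto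
  then have "(\<integral>\<^sup>+x\<in>{0..1}. ennreal (Re (G (of_real x))) \<partial>lebesgue)
    \<le> (\<integral>\<^sup>+x. ennreal (1/2) * ennreal (indicator {-1..2} x * (Re (G (of_real x)) * ((x + 1) * (2 - x)))) \<partial>lebesgue)"
    by (intro nn_integral_mono)
  also have "\<dots> = ennreal (1/2) * (\<integral>\<^sup>+x. ennreal (indicator {-1..2} x * (Re (G (of_real x)) * ((x + 1) * (2 - x)))) \<partial>lebesgue)"
  proof (rule nn_integral_cmult)
    have "continuous_on UNIV (\<lambda>x::real. G (of_real x))"
      using \<open>e > 0\<close> by (intro continuous_on_compose2[OF holomorphic_on_imp_continuous_on[OF hol]] continuous_intros) auto
    then have "(\<lambda>x::real. G (of_real x)) \<in> borel_measurable lebesgue"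
      by (intro borel_measurable_lebesgueI borel_measurable_continuous_onI)
    moreover have "(\<lambda>x::real. x) \<in> borel_measurable lebesgue"
      by (intro borel_measurable_lebesgueI) simp
    ultimately show "(\<lambda>x. ennreal (indicator {-1..2} x * (Re (G (of_real x)) * ((x + 1) * (2 - x))))) \<in> borel_measurable lebesgue"
      by measurable
  qed
  also have "\<dots> \<le> ennreal (1/2) * ennreal (9 * pi / 2 * K)"
    by (intro mult_left_mono le) auto
  also have "\<dots> = ennreal (9 * pi / 4 * K)"
    using K0 by (subst ennreal_mult''[symmetric]) (auto simp: field_simps)
  finally show ?thesis .
qed

lemma Re_i_inverse: "Re (\<i> * (1 / u)) = Im u / (cmod u)\<^sup>2"
  by (simp add: Re_divide cmod_power2)

text \<open>With the poles below the real axis and the argument raised by \<open>e\<close>, the sum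
  is holomorphic on a neighbourhood of the closed upper half plane and bounded by N / Im z above the
  axis. The majorant \<open>G\<close> then satisfies the half disc estimate with K = N / sqrt T, and
  the choice of \<open>T\<close> balances the resulting bounds sqrt(2T) |E| and O(N / sqrt
  T).\<close>

lemma sqrt_cauchy_sum_integral_shifted:
  fixes zs :: "complex list" and N :: real
  assumes low: "\<forall>w\<in>set zs. Im w \<le> 0" and E: "E \<in> sets lebesgue" "E \<subseteq> {0..1}"
    and N: "real (length zs) \<le> N" "N > 0" and e: "e > 0" and pos: "measure lebesgue E > 0"
  shows "(\<integral>\<^sup>+x\<in>E. ennreal (sqrt (cmod (\<Sum>w\<leftarrow>zs. 1 / (of_real x + \<i> * of_real e - w)))) \<partial>lebesgue)
    \<le> ennreal (25 * sqrt (N * measure lebesgue E))"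
proof -
  define m where "m = measure lebesgue E"
  define T where "T = N / m"
  have m: "0 < m" using pos by (simp add: m_def)
  have T: "T > 0" using N m by (simp add: T_def)
  have emE: "emeasure lebesgue E = ennreal m"
    unfolding m_def using E by (intro emeasure_eq_measure2 bounded_set_imp_lmeasurable) (auto intro: bounded_subset[OF bounded_closed_interval])
  \<comment> \<open>The factor \<open>\<i>\<close> makes every summand a Poisson kernel in its real
    part, Im u / |u|^2, so \<open>F\<close> takes values in the closed right half plane.\<close>
  define F where "F z = \<i> * (\<Sum>w\<leftarrow>zs. 1 / (z + \<i> * of_real e - w))" for z
  define G where "G z = F z / csqrt (F z + of_real T)" for z
  have F_eq: "F z = (\<Sum>w\<leftarrow>zs. \<i> * (1 / (z + \<i> * of_real e - w)))" for z
    unfolding F_def by (simp add: sum_list_const_mult[symmetric])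
  have ReF: "Re (F z) \<ge> 0" if "Im z > - e" for z
    unfolding F_eq using low that
  proof (induction zs)
    case (Cons a zs)
    have "Re (\<i> * (1 / (z + \<i> * of_real e - a))) \<ge> 0"
      unfolding Re_i_inverse using Cons.prems by (intro divide_nonneg_nonneg) auto
    then show ?case using Cons by auto
  qed simp
  have nF: "cmod (F z) \<le> N / Im z" if "Im z > 0" for z
  proof -
    have "cmod (F z) \<le> real (length zs) / Im z"
      unfolding F_eq using low
    proof (induction zs)
      case (Cons a zs)
      have "Im z \<le> cmod (z + \<i> * of_real e - a)"
        using abs_Im_le_cmod[of "z + \<i> * of_real e - a"] Cons.prems that e by auto
      then have "cmod (\<i> * (1 / (z + \<i> * of_real e - a))) \<le> 1 / Im z"
        using that by (simp add: norm_divide norm_mult frac_le)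
      then show ?case using Cons norm_triangle_le[of "\<i> * (1 / (z + \<i> * of_real e - a))"]
        by (auto simp: add_divide_distrib intro!: norm_triangle_le)
    qed simp
    also have "\<dots> \<le> N / Im z" using N that by (intro divide_right_mono) auto
    finally show ?thesis .
  qed
  have holF: "F holomorphic_on {z. Im z > - e}"
    unfolding F_def using low
  proof (induction zs)
    case (Cons a zs)
    have "z + \<i> * of_real e - a \<noteq> 0" if "Im z > - e" for z
      using Cons.prems that by (auto simp: complex_eq_iff)
    then show ?case using Cons by (auto simp: distrib_left intro!: holomorphic_intros)
  qed simp
  have holG: "G holomorphic_on {z. Im z > - e}"
  proof -
    have "F z + of_real T \<notin> \<real>\<^sub>\<le>\<^sub>0" "F z + of_real T \<noteq> 0" if "Im z > - e" for z
    proof -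
      have "Re (F z + of_real T) > 0" using ReF[OF that] T by simp
      then show "F z + of_real T \<notin> \<real>\<^sub>\<le>\<^sub>0" "F z + of_real T \<noteq> 0"
        by (auto simp: complex_nonpos_Reals_iff complex_eq_iff)
    qed
    then show ?thesis unfolding G_def using holF by (intro holomorphic_intros) auto
  qed
  have "(\<integral>\<^sup>+x\<in>{0..1}. ennreal (Re (G (of_real x))) \<partial>lebesgue) \<le> ennreal (9 * pi / 4 * (N / sqrt T))"
  proof (rule half_disc_integral_bound[OF holG e])
    fix z :: complex assume z: "Im z > 0"
    then have "cmod (G z) \<le> cmod (F z) / sqrt T"
      unfolding G_def using ReF[of z] e T by (intro csqrt_quotient_bounds) auto
    also have "\<dots> \<le> (N / Im z) / sqrt T"
      using nF[OF z] T by (intro divide_right_mono) auto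
    finally show "cmod (G z) \<le> N / sqrt T / Im z" by (simp add: mult.commute)
  next
    fix x :: real
    show "Re (G x) \<ge> 0"
      unfolding G_def using ReF[of x] e T by (intro csqrt_quotient_bounds) auto
  qed
  then have int01: "(\<integral>\<^sup>+x\<in>{0..1}. ennreal (Re (G (of_real x))) \<partial>lebesgue) \<le> ennreal (9 * pi / 4 * (N / sqrt T))" .
  have contG: "continuous_on UNIV (\<lambda>x::real. G (of_real x))"
    using e by (intro continuous_on_compose2[OF holomorphic_on_imp_continuous_on[OF holG]] continuous_intros) auto
  have measG [measurable]: "(\<lambda>x::real. G (of_real x)) \<in> borel_measurable lebesgue"
    by (rule borel_measurable_lebesgueI[OF borel_measurable_continuous_onI[OF contG]])
  note [measurable] = E(1)
  have [measurable]: "{0..1::real} \<in> sets lebesgue" by simp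
  \<comment> \<open>The constant part of the majorant is integrated over \<open>E\<close> only,
    while the part with \<open>Re G\<close> is nonnegative and may be integrated over all of
    [0, 1].\<close>
  have "(\<integral>\<^sup>+x\<in>E. ennreal (sqrt (cmod (\<Sum>w\<leftarrow>zs. 1 / (of_real x + \<i> * of_real e - w)))) \<partial>lebesgue)
    \<le> (\<integral>\<^sup>+x. ennreal (sqrt (2 * T)) * indicator E x
          + ennreal (2 * sqrt 2) * (ennreal (Re (G (of_real x))) * indicator {0..1} x) \<partial>lebesgue)"
  proof (rule nn_integral_mono)
    fix x :: real
    have G: "Re (F x) \<ge> 0" using ReF[of x] e by simp
    have n: "cmod (\<Sum>w\<leftarrow>zs. 1 / (of_real x + \<i> * of_real e - w)) = cmod (F x)"
      by (simp add: F_def norm_mult)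
    have "sqrt (cmod (F x)) \<le> sqrt (2 * T) + 2 * sqrt 2 * Re (G x)"
      unfolding G_def by (rule csqrt_quotient_bounds(3)[OF G T])
    moreover have "0 \<le> Re (G x)"
      unfolding G_def by (rule csqrt_quotient_bounds(1)[OF G T])
    ultimately have "ennreal (sqrt (cmod (F x))) \<le> ennreal (sqrt (2 * T)) + ennreal (2 * sqrt 2) * ennreal (Re (G x))"
      using T by (simp add: ennreal_mult''[symmetric] ennreal_plus[symmetric] ennreal_leI del: ennreal_plus)
    then show "ennreal (sqrt (cmod (\<Sum>w\<leftarrow>zs. 1 / (of_real x + \<i> * of_real e - w)))) * indicator E x
      \<le> ennreal (sqrt (2 * T)) * indicator E x
          + ennreal (2 * sqrt 2) * (ennreal (Re (G (of_real x))) * indicator {0..1} x)"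
      unfolding n using E(2) by (auto split: split_indicator)
  qed
  also have "\<dots> = ennreal (sqrt (2 * T)) * emeasure lebesgue E
      + ennreal (2 * sqrt 2) * (\<integral>\<^sup>+x\<in>{0..1}. ennreal (Re (G (of_real x))) \<partial>lebesgue)"
  proof -
    have "(\<lambda>x. ennreal (Re (G (of_real x))) * indicator {0..1} x) \<in> borel_measurable lebesgue" by measurable
    from nn_integral_cmult[OF this] show ?thesis
      unfolding nn_integral_cmult_indicator[OF E(1), symmetric]
      by (subst nn_integral_add) simp_all
  qed
  also have "\<dots> \<le> ennreal (sqrt (2 * T)) * ennreal m + ennreal (2 * sqrt 2) * ennreal (9 * pi / 4 * (N / sqrt T))"
    unfolding emE by (intro add_mono mult_left_mono int01) auto
  also have "\<dots> = ennreal (sqrt (2 * T) * m + 2 * sqrt 2 * (9 * pi / 4 * (N / sqrt T)))"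
    using T m N by (simp add: ennreal_mult''[symmetric] ennreal_plus[symmetric] del: ennreal_plus)
  also have "\<dots> \<le> ennreal (25 * sqrt (N * m))"
  proof (rule ennreal_leI)
    \<comment> \<open>For T = N/m both terms are multiples of sqrt(N m); the total factor is at most
      3/2 + 9/2 * (3/2 * 3.2) = 23.1.\<close>
    have sN: "sqrt N * sqrt N = N" and sm: "sqrt m * sqrt m = m" using N m by auto
    have T': "sqrt T = sqrt N / sqrt m" by (simp add: T_def real_sqrt_divide)
    have a: "sqrt (2 * T) * m = sqrt 2 * sqrt (N * m)"
      unfolding real_sqrt_mult T' using m sm by (simp add: field_simps)
    have b: "N / sqrt T = sqrt (N * m)"
      unfolding real_sqrt_mult T' using m N sN by (simp add: field_simps)
    have "sqrt 2 \<le> 3/2" by (rule real_le_lsqrt) (auto simp: power2_eq_square)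
    then have "sqrt 2 * pi \<le> 3/2 * (3.2)"
      using pi_approx by (intro mult_mono) auto
    then have "sqrt 2 + 2 * sqrt 2 * (9 * pi / 4) \<le> 25" using \<open>sqrt 2 \<le> 3/2\<close> by (simp add: algebra_simps)
    then have "(sqrt 2 + 2 * sqrt 2 * (9 * pi / 4)) * sqrt (N * m) \<le> 25 * sqrt (N * m)"
      using N m by (intro mult_right_mono) auto
    then show "sqrt (2 * T) * m + 2 * sqrt 2 * (9 * pi / 4 * (N / sqrt T)) \<le> 25 * sqrt (N * m)"
      unfolding a b by (simp add: algebra_simps)
  qed
  finally show ?thesis unfolding m_def .
qed

text \<open>The shifted bound does not depend on the shift, so the shift can tend to 0. This also
  admits poles on the real axis itself.\<close>

lemma sqrt_cauchy_sum_integral_lower: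
  fixes zs :: "complex list" and N :: real
  assumes low: "\<forall>w\<in>set zs. Im w \<le> 0" and E: "E \<in> sets lebesgue" "E \<subseteq> {0..1}"
    and N: "real (length zs) \<le> N" "N > 0"
  shows "(\<integral>\<^sup>+x\<in>E. ennreal (sqrt (cmod (\<Sum>w\<leftarrow>zs. 1 / (of_real x - w)))) \<partial>lebesgue)
    \<le> ennreal (25 * sqrt (N * measure lebesgue E))"
proof (cases "measure lebesgue E > 0")
  case False
  have "E \<in> lmeasurable" using E by (intro bounded_set_imp_lmeasurable) (auto intro: bounded_subset[OF bounded_closed_interval])
  then have "E \<in> null_sets lebesgue"
    using False E by (simp add: emeasure_eq_measure2 null_sets_def zero_less_measure_iff)
  then show ?thesis by (simp add: nn_integral_null_set)
next
  case True
  define u where "u k x = sqrt (cmod (\<Sum>w\<leftarrow>zs. 1 / (of_real x + \<i> * of_real (inverse (real (Suc k))) - w)))" for k x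
  define v where "v x = sqrt (cmod (\<Sum>w\<leftarrow>zs. 1 / (of_real x - w)))" for x :: real
  note [measurable] = E(1)
  have [measurable]: "u k \<in> borel_measurable lebesgue" for k
  proof -
    have "of_real x + \<i> * of_real (inverse (real (Suc k))) - w \<noteq> 0" if "w \<in> set zs" for w and x :: real
    proof -
      have "inverse (real (Suc k)) > 0" by simp
      moreover have "Im (of_real x + \<i> * of_real (inverse (real (Suc k))) - w) = inverse (real (Suc k)) - Im w"
        by (simp only: plus_complex.sel minus_complex.sel times_complex.sel) (simp del: of_nat_Suc of_real_inverse)
      ultimately have "Im (of_real x + \<i> * of_real (inverse (real (Suc k))) - w) > 0"
        using low[rule_format, OF that] by linarith
      then show ?thesis by auto
    qed
    then have "continuous_on UNIV (\<lambda>x::real. (\<Sum>w\<leftarrow>zs. 1 / (of_real x + \<i> * of_real (inverse (real (Suc k))) - w)))"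
      by (induction zs) (auto intro!: continuous_intros)
    then have "continuous_on UNIV (u k)" unfolding u_def by (intro continuous_intros)
    then show ?thesis
      by (intro borel_measurable_lebesgueI borel_measurable_continuous_onI)
  qed
  have lim: "(\<lambda>k. u k x) \<longlonglongrightarrow> v x" if "of_real x \<notin> set zs" for x
  proof -
    have "(\<lambda>k. \<Sum>w\<leftarrow>zs. 1 / (of_real x + \<i> * of_real (inverse (real (Suc k))) - w)) \<longlonglongrightarrow> (\<Sum>w\<leftarrow>zs. 1 / (of_real x - w))"
      using that
    proof (induction zs)
      case (Cons a zs)
      have "(\<lambda>k. 1 / (of_real x + \<i> * of_real (inverse (real (Suc k))) - a)) \<longlonglongrightarrow> 1 / (of_real x + \<i> * of_real 0 - a)"
        using Cons.prems by (intro tendsto_intros LIMSEQ_inverse_real_of_nat) auto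
      then show ?case using Cons by (auto intro!: tendsto_add)
    qed simp
    then show ?thesis unfolding u_def v_def by (intro tendsto_intros)
  qed
  have "finite (of_real -` set zs :: real set)"
    by (intro finite_vimageI) (auto simp: inj_on_def)
  then have "(of_real -` set zs :: real set) \<in> null_sets lebesgue"
    using finite_imp_null_set_lborel null_sets_completionI by blast
  then have AE: "AE x in lebesgue. of_real x \<notin> set zs"
    using AE_not_in by fastforce
  \<comment> \<open>Off the finite set of real poles \<open>u k\<close> converges to
    \<open>v\<close>, and Fatou's lemma carries the uniform bound to the limit.\<close>
  have "(\<integral>\<^sup>+x\<in>E. ennreal (v x) \<partial>lebesgue) \<le> (\<integral>\<^sup>+x. liminf (\<lambda>k. ennreal (u k x) * indicator E x) \<partial>lebesgue)"
  proof (rule nn_integral_mono_AE, use AE in eventually_elim)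
    case (elim x)
    have "(\<lambda>k. ennreal (u k x) * indicator E x) \<longlonglongrightarrow> ennreal (v x) * indicator E x"
      using lim[OF elim] by (cases "x \<in> E") (auto intro!: tendsto_ennrealI)
    then show ?case by (simp add: lim_imp_Liminf)
  qed
  also have "\<dots> \<le> liminf (\<lambda>k. \<integral>\<^sup>+x\<in>E. ennreal (u k x) \<partial>lebesgue)"
    by (intro nn_integral_liminf) measurable
  also have "\<dots> \<le> ennreal (25 * sqrt (N * measure lebesgue E))"
  proof (rule Liminf_le)
    show "\<forall>\<^sub>F k in sequentially. (\<integral>\<^sup>+x\<in>E. ennreal (u k x) \<partial>lebesgue) \<le> ennreal (25 * sqrt (N * measure lebesgue E))"
      unfolding u_def by (intro always_eventually allI sqrt_cauchy_sum_integral_shifted low E N True) simp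
  qed simp
  finally show ?thesis unfolding v_def .
qed

text \<open>Poles in the upper half plane are reflected: for real x, conjugating the sum conjugates
  its poles and preserves its modulus. Subadditivity of the square root adds the two halves, which
  doubles the constant.\<close>

lemma sqrt_cauchy_sum_integral:
  fixes zs :: "complex list" and N :: real
  assumes E: "E \<in> sets lebesgue" "E \<subseteq> {0..1}"
    and N: "real (length zs) \<le> N" "N > 0"
  shows "(\<integral>\<^sup>+x\<in>E. ennreal (sqrt (cmod (\<Sum>w\<leftarrow>zs. 1 / (of_real x - w)))) \<partial>lebesgue)
    \<le> ennreal (50 * sqrt (N * measure lebesgue E))"
proof -
  define z1 where "z1 = filter (\<lambda>w. Im w \<le> 0) zs"
  define z2 where "z2 = map cnj (filter (\<lambda>w. \<not> Im w \<le> 0) zs)"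
  define f where "f ws x = sqrt (cmod (\<Sum>w\<leftarrow>ws. 1 / (of_real x - w)))" for ws :: "complex list" and x :: real
  note [measurable] = E(1)
  have [measurable]: "f ws \<in> borel_measurable lebesgue" for ws
  proof -
    have "(\<lambda>x::real. \<Sum>w\<leftarrow>ws. 1 / (complex_of_real x - w)) \<in> borel_measurable borel"
      by (induction ws) (auto intro!: borel_measurable_add borel_measurable_divide borel_measurable_diff
          borel_measurable_continuous_onI continuous_intros)
    then have "f ws \<in> borel_measurable borel" unfolding f_def by measurable
    then show ?thesis by (rule borel_measurable_lebesgueI)
  qed
  have f_le: "f zs x \<le> f z1 x + f z2 x" for x
  proof -
    have "(\<Sum>w\<leftarrow>zs. 1 / (of_real x - w)) = (\<Sum>w\<leftarrow>z1. 1 / (of_real x - w)) + cnj (\<Sum>w\<leftarrow>z2. 1 / (of_real x - w))"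
      unfolding z1_def z2_def by (induction zs) auto
    then have "cmod (\<Sum>w\<leftarrow>zs. 1 / (of_real x - w)) \<le> cmod (\<Sum>w\<leftarrow>z1. 1 / (of_real x - w)) + cmod (\<Sum>w\<leftarrow>z2. 1 / (of_real x - w))"
      by (metis complex_mod_cnj norm_triangle_ineq)
    then have "f zs x \<le> sqrt (cmod (\<Sum>w\<leftarrow>z1. 1 / (of_real x - w)) + cmod (\<Sum>w\<leftarrow>z2. 1 / (of_real x - w)))"
      unfolding f_def by simp
    also have "\<dots> \<le> f z1 x + f z2 x" unfolding f_def by (rule sqrt_add_le_add_sqrt) auto
    finally show ?thesis .
  qed
  have f0: "f ws x \<ge> 0" for ws x by (simp add: f_def)
  have len: "real (length z1) \<le> N" "real (length z2) \<le> N"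
    using N(1) length_filter_le[of "\<lambda>w. Im w \<le> 0" zs] length_filter_le[of "\<lambda>w. \<not> Im w \<le> 0" zs]
    unfolding z1_def z2_def length_map by linarith+
  have "(\<integral>\<^sup>+x\<in>E. ennreal (f zs x) \<partial>lebesgue)
      \<le> (\<integral>\<^sup>+x. ennreal (f z1 x) * indicator E x + ennreal (f z2 x) * indicator E x \<partial>lebesgue)"
    using f_le f0 by (intro nn_integral_mono) (auto split: split_indicator simp: ennreal_plus[symmetric] simp del: ennreal_plus intro!: ennreal_leI)
  also have "\<dots> = (\<integral>\<^sup>+x\<in>E. ennreal (f z1 x) \<partial>lebesgue) + (\<integral>\<^sup>+x\<in>E. ennreal (f z2 x) \<partial>lebesgue)"
    by (rule nn_integral_add) simp_all
  also have "\<dots> \<le> ennreal (25 * sqrt (N * measure lebesgue E)) + ennreal (25 * sqrt (N * measure lebesgue E))"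
    unfolding f_def by (intro add_mono sqrt_cauchy_sum_integral_lower E len N) (auto simp: z1_def z2_def)
  also have "\<dots> = ennreal (50 * sqrt (N * measure lebesgue E))"
    using N by (subst ennreal_plus[symmetric]) auto
  finally show ?thesis unfolding f_def .
qed

section \<open>Logarithmic derivatives of entire functions\<close>

lemma norm_prod_list_diff_le:
  fixes z :: complex
  assumes "\<forall>w\<in>set ws. cmod (z - w) \<le> r"
  shows "cmod (\<Prod>w\<leftarrow>ws. z - w) \<le> r ^ length ws"
  using assms
proof (induction ws)
  case (Cons a ws)
  then show ?case by (auto simp: norm_mult intro!: mult_mono order_trans[OF norm_ge_zero])
qed simp

lemma norm_prod_list_diff_ge:
  fixes z :: complex
  assumes "\<forall>w\<in>set ws. r \<le> cmod (z - w)" "r \<ge> 0"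
  shows "r ^ length ws \<le> cmod (\<Prod>w\<leftarrow>ws. z - w)"
  using assms
proof (induction ws)
  case (Cons a ws)
  then show ?case by (auto simp: norm_mult intro!: mult_mono)
qed simp

text \<open>A Jensen type count. On the circle of radius 16 each linear factor has modulus at least
  12, at the centre at most 4, so dividing it out gains a factor 3. By the maximum principle the
  gain reaches the centre, which gives 3^n <= exp B, and e < 3 turns this into n <= B.\<close>

lemma factor_out_zeros_bound:
  assumes q: "cmod (q z0) \<noteq> 0" "\<And>z. cmod (z - z0) \<le> 16 \<Longrightarrow> cmod (q z) \<le> exp B * cmod (q z0)"
    and g: "g holomorphic_on UNIV" "\<And>z. q z = (\<Prod>w\<leftarrow>ws. z - w) * g z" "set ws \<subseteq> cball z0 4"
  shows "real (length ws) \<le> B" "cmod (z - z0) \<le> 16 \<Longrightarrow> cmod (g z) \<le> exp B * cmod (g z0)"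
proof -
  define n where "n = length ws"
  have g0: "g z0 \<noteq> 0" using q(1) g(2)[of z0] by auto
  have up: "cmod (q z0) \<le> 4 ^ n * cmod (g z0)"
    unfolding g(2)[of z0] norm_mult n_def using g(3)
    by (intro mult_right_mono norm_prod_list_diff_le) (auto simp: dist_norm)
  have sphere: "cmod (g z) \<le> exp B * cmod (g z0) / 3 ^ n" if "cmod (z - z0) = 16" for z
  proof -
    have "12 \<le> cmod (z - w)" if w: "w \<in> set ws" for w
    proof -
      have "cmod (z0 - w) \<le> 4" using w g(3) by (auto simp: dist_norm)
      then show ?thesis using norm_triangle_ineq[of "z - w" "w - z0"] \<open>cmod (z - z0) = 16\<close>
        by (simp add: norm_minus_commute)
    qed
    then have "12 ^ n * cmod (g z) \<le> cmod (q z)"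
      unfolding g(2)[of z] norm_mult n_def by (intro mult_right_mono norm_prod_list_diff_ge) auto
    also have "\<dots> \<le> exp B * cmod (q z0)" using q(2) that by simp
    also have "\<dots> \<le> exp B * (4 ^ n * cmod (g z0))" by (intro mult_left_mono up) simp
    finally have "(12::real) ^ n * cmod (g z) \<le> exp B * (4 ^ n * cmod (g z0))" .
    moreover have "(12::real) ^ n = 4 ^ n * 3 ^ n" by (simp flip: power_mult_distrib)
    ultimately show ?thesis by (simp add: field_simps)
  qed
  have cball: "cmod (g z) \<le> exp B * cmod (g z0) / 3 ^ n" if "cmod (z - z0) \<le> 16" for z
  proof (rule maximum_modulus_frontier[of g "cball z0 16"])
    show "continuous_on (closure (cball z0 16)) g"
      using g(1) holomorphic_on_imp_continuous_on holomorphic_on_subset by blast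
    show "g holomorphic_on interior (cball z0 16)" using g(1) holomorphic_on_subset by blast
  qed (use that sphere in \<open>auto simp: dist_norm norm_minus_commute\<close>)
  from cball[of z0] g0 have "3 ^ n \<le> exp B" by (simp add: field_simps)
  moreover have "exp (real n) \<le> 3 ^ n"
    using exp_le by (subst exp_of_nat_mult[of n 1, simplified]) (auto intro: power_mono)
  ultimately have "exp (real n) \<le> exp B" by linarith
  then show "real (length ws) \<le> B" by (simp add: n_def)
  show "cmod (g z) \<le> exp B * cmod (g z0)" if "cmod (z - z0) \<le> 16"
  proof -
    have "exp B * cmod (g z0) / 3 ^ n \<le> exp B * cmod (g z0) / 1"
      by (intro divide_left_mono) auto
    with cball[OF that] show ?thesis by simp
  qed
qed

text \<open>Zeros in the disc of radius 4 are divided out with multiplicity. The number of factors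
  never exceeds \<open>B\<close>, so a factorisation with the longest list exists, and its cofactor
  has no zero left in the disc.\<close>

lemma factor_out_zeros:
  assumes hol: "q holomorphic_on UNIV" and q0: "q z0 \<noteq> 0"
    and bound: "\<And>z. cmod (z - z0) \<le> 16 \<Longrightarrow> cmod (q z) \<le> exp B * cmod (q z0)"
  obtains ws g where "g holomorphic_on UNIV" "\<And>z. q z = (\<Prod>w\<leftarrow>ws. z - w) * g z"
    "\<And>z. cmod (z - z0) \<le> 4 \<Longrightarrow> g z \<noteq> 0" "real (length ws) \<le> B"
    "\<And>z. cmod (z - z0) \<le> 16 \<Longrightarrow> cmod (g z) \<le> exp B * cmod (g z0)"
proof -
  define P where "P ws g \<longleftrightarrow> g holomorphic_on UNIV \<and> (\<forall>z. q z = (\<Prod>w\<leftarrow>ws. z - w) * g z) \<and> set ws \<subseteq> cball z0 4" for ws g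
  have len: "real (length ws) \<le> B" if "P ws g" for ws g
    using that q0 bound unfolding P_def by (intro factor_out_zeros_bound(1)[where q=q and g=g]) auto
  define Q where "Q n \<longleftrightarrow> (\<exists>ws g. P ws g \<and> length ws = n)" for n
  have "P [] q" using hol by (simp add: P_def)
  then have "Q 0" by (auto simp: Q_def)
  moreover have "n \<le> nat \<lceil>B\<rceil>" if "Q n" for n
    using that len unfolding Q_def by (metis of_nat_le_iff real_nat_ceiling_ge order_trans)
  ultimately have "\<exists>n. Q n \<and> (\<forall>m. Q m \<longrightarrow> m \<le> n)"
    by (intro Nat.ex_has_greatest_nat) auto
  then obtain ws g where P: "P ws g" and max: "\<And>ws' g'. P ws' g' \<Longrightarrow> length ws' \<le> length ws"
    unfolding Q_def by blast
  have "g z \<noteq> 0" if "cmod (z - z0) \<le> 4" for z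
  proof
    assume g0: "g z = 0"
    \<comment> \<open>The difference quotient has a removable singularity at \<open>z\<close>,
      filled by the derivative. It splits off one more linear factor, against maximality.\<close>
    define k where "k w = (if w = z then deriv g z else (g w - g z) / (w - z))" for w
    have "k holomorphic_on UNIV"
      unfolding k_def using P by (intro pole_lemma_open) (auto simp: P_def)
    moreover have "g w = (w - z) * k w" for w by (simp add: k_def g0)
    then have "q w = (\<Prod>w'\<leftarrow>z # ws. w - w') * k w" for w
      using P by (simp add: P_def mult_ac)
    ultimately have "P (z # ws) k"
      using P that by (auto simp: P_def dist_norm norm_minus_commute)
    from max[OF this] show False by simp
  qed
  moreover have g: "g holomorphic_on UNIV" "\<And>z. q z = (\<Prod>w\<leftarrow>ws. z - w) * g z" "set ws \<subseteq> cball z0 4"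
    using P by (auto simp: P_def)
  moreover have "cmod (g z) \<le> exp B * cmod (g z0)" if "cmod (z - z0) \<le> 16" for z
    by (rule factor_out_zeros_bound(2)[OF _ bound g that]) (use q0 in auto)
  ultimately show thesis
    using len[OF P] by (intro that[of g ws]) auto
qed

text \<open>The map h / (2A - h) sends the half plane Re h < A into the unit disc and fixes 0, so
  the Schwarz lemma gives |h| <= 3/4 (2A + |h|), that is |h| <= 6A, within distance 3 of the centre.
  Cauchy's inequality on unit circles then bounds the derivative within distance 2.\<close>

lemma Borel_Caratheodory_deriv:
  assumes hol: "h holomorphic_on ball z0 4" and h0: "h z0 = 0"
    and Re: "\<And>z. cmod (z - z0) < 4 \<Longrightarrow> Re (h z) < A" and z: "cmod (z - z0) \<le> 2"
  shows "cmod (deriv h z) \<le> 6 * A"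
proof -
  have A: "A > 0" using Re[of z0] h0 by simp
  define k where "k u = h (z0 + 4 * u) / (2 * of_real A - h (z0 + 4 * u))" for u
  have in4: "cmod (z0 + 4 * u - z0) < 4" if "cmod u < 1" for u
    using that by (simp add: norm_mult)
  have ne: "2 * of_real A - h (z0 + 4 * u) \<noteq> 0" if "cmod u < 1" for u
    using Re[OF in4[OF that]] A by (auto simp: complex_eq_iff)
  have holk: "k holomorphic_on ball 0 1"
  proof -
    have "(\<lambda>u. h (z0 + 4 * u)) holomorphic_on ball 0 1"
      by (rule holomorphic_on_compose_gen[OF _ hol, unfolded o_def])
         (auto intro!: holomorphic_intros simp: dist_norm norm_mult)
    then show ?thesis unfolding k_def using ne by (intro holomorphic_intros) auto
  qed
  have k1: "cmod (k u) < 1" if "cmod u < 1" for u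
  proof -
    define w where "w = h (z0 + 4 * u)"
    have "Re w < A" unfolding w_def by (rule Re[OF in4[OF that]])
    then have "0 < A * (A - Re w)" using A by simp
    then have "(cmod w)\<^sup>2 < (cmod (2 * of_real A - w))\<^sup>2"
      unfolding cmod_power2 by (simp add: power2_eq_square algebra_simps)
    then have "cmod w < cmod (2 * of_real A - w)" using power2_less_imp_less norm_ge_zero by blast
    then show ?thesis unfolding k_def w_def[symmetric] norm_divide
      by (simp add: divide_less_eq)
  qed
  have kle: "cmod (k u) \<le> cmod u" if "cmod u < 1" for u
    by (rule Schwarz_Lemma(1)[OF holk _ k1 that]) (auto simp: k_def h0)
  have h_le: "cmod (h x) \<le> 6 * A" if x: "cmod (x - z0) \<le> 3" for x
  proof -
    define u where "u = (x - z0) / 4"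
    have u: "cmod u \<le> 3/4" using x by (simp add: u_def norm_divide)
    have xu: "z0 + 4 * u = x" by (simp add: u_def diff_divide_distrib)
    have "cmod (h x) = cmod (k u) * cmod (2 * of_real A - h x)"
      using ne[of u] u by (simp add: k_def xu norm_divide)
    also have "\<dots> \<le> 3/4 * (2 * A + cmod (h x))"
      using kle[of u] u A norm_triangle_ineq4[of "2 * of_real A" "h x"]
      by (intro mult_mono) (auto simp: norm_mult)
    finally show ?thesis by simp
  qed
  have "cmod ((deriv ^^ 1) h z) \<le> fact 1 * (6 * A) / 1 ^ 1"
  proof (rule Cauchy_inequality)
    have sub: "cball z 1 \<subseteq> ball z0 4"
    proof
      fix x assume "x \<in> cball z 1"
      then show "x \<in> ball z0 4" using z norm_triangle_ineq[of "x - z" "z - z0"]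
        by (auto simp: dist_norm norm_minus_commute)
    qed
    then show "h holomorphic_on ball z 1"
      using hol ball_subset_cball holomorphic_on_subset by blast
    show "continuous_on (cball z 1) h"
      using hol sub holomorphic_on_imp_continuous_on holomorphic_on_subset by blast
    show "cmod (h x) \<le> 6 * A" if "cmod (z - x) = 1" for x
      using that z norm_triangle_ineq[of "x - z" "z - z0"] by (intro h_le) (auto simp: norm_minus_commute)
  qed simp
  then show ?thesis by simp
qed

text \<open>A zero-free function on a disc has a holomorphic logarithm, whose derivative is the
  logarithmic derivative. The growth bound says that the real part of the logarithm rises by at most
  \<open>B\<close> from its value at the centre; \<open>B + 1\<close> makes the inequality strict,
  as Borel-Caratheodory requires.\<close>

lemma log_deriv_zero_free_bound:
  assumes hol: "g holomorphic_on UNIV"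
    and nz: "\<And>z. cmod (z - z0) \<le> 4 \<Longrightarrow> g z \<noteq> 0"
    and bound: "\<And>z. cmod (z - z0) \<le> 16 \<Longrightarrow> cmod (g z) \<le> exp B * cmod (g z0)"
    and z: "cmod (z - z0) \<le> 2"
  shows "cmod (deriv g z / g z) \<le> 6 * (B + 1)"
proof -
  have holb: "g holomorphic_on ball z0 4" using hol holomorphic_on_subset by blast
  obtain h where h: "h holomorphic_on ball z0 4" and gh: "\<And>z. z \<in> ball z0 4 \<Longrightarrow> g z = exp (h z)"
    using contractible_imp_holomorphic_log[OF holb convex_imp_contractible[OF convex_ball]] nz
    by (metis dist_commute dist_norm less_imp_le mem_ball)
  define k where "k w = h w - h z0" for w
  have "cmod (deriv k z) \<le> 6 * (B + 1)"
  proof (rule Borel_Caratheodory_deriv[where ?z0.0=z0])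
    show "k holomorphic_on ball z0 4" unfolding k_def by (intro holomorphic_intros h)
    fix w assume w: "cmod (w - z0) < 4"
    have "cmod (exp (h w)) \<le> exp B * cmod (exp (h z0))"
      using bound[of w] w gh[of w] gh[of z0] by (auto simp: dist_norm norm_minus_commute)
    then have "exp (Re (h w)) \<le> exp (B + Re (h z0))" by (simp add: exp_add)
    then show "Re (k w) < B + 1" by (simp add: k_def)
  qed (auto simp: k_def z)
  moreover have "deriv k z = deriv g z / g z"
  proof -
    have zb: "z \<in> ball z0 4" using z by (auto simp: dist_norm norm_minus_commute)
    have dh: "(h has_field_derivative deriv h z) (at z)"
      using h zb holomorphic_derivI[OF h open_ball zb] by simp
    then have "deriv k z = deriv h z" unfolding k_def
      by (intro DERIV_imp_deriv) (auto intro!: derivative_eq_intros)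
    moreover have "((\<lambda>z. exp (h z)) has_field_derivative exp (h z) * deriv h z) (at z)"
      using dh by (auto intro!: derivative_eq_intros)
    then have "(g has_field_derivative exp (h z) * deriv h z) (at z)"
      by (rule has_field_derivative_transform_within_open[OF _ open_ball zb]) (simp add: gh)
    then have "deriv g z = g z * deriv h z" using gh[OF zb] DERIV_imp_deriv by simp
    ultimately show ?thesis using gh[OF zb] by simp
  qed
  ultimately show ?thesis by simp
qed

lemma has_field_derivative_prod_list_diff:
  fixes z :: complex
  assumes "z \<notin> set ws"
  shows "((\<lambda>z. \<Prod>w\<leftarrow>ws. z - w) has_field_derivative (\<Prod>w\<leftarrow>ws. z - w) * (\<Sum>w\<leftarrow>ws. 1 / (z - w))) (at z)"
  using assms
proof (induction ws)
  case (Cons a ws)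
  then have "z - a \<noteq> 0" "((\<lambda>z. \<Prod>w\<leftarrow>ws. z - w) has_field_derivative (\<Prod>w\<leftarrow>ws. z - w) * (\<Sum>w\<leftarrow>ws. 1 / (z - w))) (at z)"
    by auto
  then have "((\<lambda>z. (z - a) * (\<Prod>w\<leftarrow>ws. z - w)) has_field_derivative
     1 * (\<Prod>w\<leftarrow>ws. z - w) + (\<Prod>w\<leftarrow>ws. z - w) * (\<Sum>w\<leftarrow>ws. 1 / (z - w)) * (z - a)) (at z)"
    by (intro DERIV_mult) (auto intro!: derivative_eq_intros)
  moreover have "(z - a) * p * (1 / (z - a) + u) = 1 * p + p * u * (z - a)" for p u
    using \<open>z - a \<noteq> 0\<close> by (simp add: field_simps)
  ultimately show ?case by (simp only: list.map prod_list.Cons sum_list.Cons)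
qed simp

text \<open>After factoring out the zeros, q'/q is a sum of at most \<open>B\<close> simple poles
  plus g'/g, and the latter is at most 6(B + 1) <= 12B. Kolmogorov's inequality handles the poles.
  The interval [0, 1] lies within distance 2 of \<open>z0\<close>, where both the factorisation and
  the bound on g'/g are available.\<close>

lemma log_deriv_sqrt_integral:
  assumes hol: "q holomorphic_on UNIV" and q0: "q z0 \<noteq> 0" and z0: "cmod (z0 - 1/2) \<le> 1"
    and bound: "\<And>z. cmod (z - z0) \<le> 16 \<Longrightarrow> cmod (q z) \<le> exp B * cmod (q z0)" and B: "B \<ge> 1"
  shows "finite {x::real. x \<in> {0..1} \<and> q (of_real x) = 0}"
    and "\<lbrakk>E \<in> sets lebesgue; E \<subseteq> {0..1}\<rbrakk> \<Longrightarrow> (\<integral>\<^sup>+x\<in>E. ennreal (sqrt (cmod (deriv q (of_real x) / q (of_real x)))) \<partial>lebesgue) \<le> ennreal (54 * sqrt (B * measure lebesgue E))"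
proof -
  obtain ws g where g: "g holomorphic_on UNIV" "\<And>z. q z = (\<Prod>w\<leftarrow>ws. z - w) * g z"
    "\<And>z. cmod (z - z0) \<le> 4 \<Longrightarrow> g z \<noteq> 0" "real (length ws) \<le> B"
    "\<And>z. cmod (z - z0) \<le> 16 \<Longrightarrow> cmod (g z) \<le> exp B * cmod (g z0)"
    using factor_out_zeros[OF hol q0 bound] by metis
  have near: "cmod (of_real x - z0) \<le> 2" if "x \<in> {0..1}" for x
  proof -
    have "of_real x - 1/2 = (of_real (x - 1/2) :: complex)" by simp
    then have "cmod (of_real x - 1/2) = \<bar>x - 1/2\<bar>" by (metis norm_of_real real_norm_def)
    then show ?thesis
      using norm_triangle_ineq[of "of_real x - 1/2" "1/2 - z0"] that z0 by (auto simp: norm_minus_commute)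
  qed
  have "{x::real. x \<in> {0..1} \<and> q (of_real x) = 0} \<subseteq> of_real -` set ws"
  proof
    fix x :: real assume "x \<in> {x. x \<in> {0..1} \<and> q (of_real x) = 0}"
    then have "q x = 0" "g x \<noteq> 0" using g(3)[of "of_real x"] near[of x] by auto
    then have "(\<Prod>w\<leftarrow>ws. of_real x - w) = 0" unfolding g(2) by simp
    then show "x \<in> of_real -` set ws" by (auto simp: prod_list_zero_iff)
  qed
  moreover have "finite (of_real -` set ws :: real set)"
    by (intro finite_vimageI) (auto simp: inj_on_def)
  ultimately show "finite {x::real. x \<in> {0..1} \<and> q (of_real x) = 0}"
    by (rule finite_subset)
  assume E: "E \<in> sets lebesgue" "E \<subseteq> {0..1}"
  note [measurable] = E(1)
  define S where "S x = (\<Sum>w\<leftarrow>ws. 1 / (of_real x - w))" for x :: real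
  define m where "m = measure lebesgue E"
  have lE: "E \<in> lmeasurable" using E by (intro bounded_set_imp_lmeasurable) (auto intro: bounded_subset[OF bounded_closed_interval])
  have m: "0 \<le> m" "m \<le> 1"
    using measure_mono_fmeasurable[OF E(2) E(1)] by (auto simp: m_def)
  have [measurable]: "S \<in> borel_measurable lebesgue"
    unfolding S_def
    by (rule borel_measurable_lebesgueI, induction ws)
       (auto intro!: borel_measurable_add borel_measurable_divide borel_measurable_diff
          borel_measurable_continuous_onI continuous_intros)
  have le: "sqrt (cmod (deriv q (of_real x) / q (of_real x))) \<le> sqrt (cmod (S x)) + sqrt (12 * B)" if x: "x \<in> {0..1}" for x
  proof (cases "q (of_real x) = 0")
    case False
    have gx: "g x \<noteq> 0" using g(3) near[OF x] by simp
    have xw: "of_real x \<notin> set ws" using False by (auto simp: g(2) prod_list_zero_iff)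
    have "(g has_field_derivative deriv g x) (at (of_real x))"
      using holomorphic_derivI[OF g(1) open_UNIV] by simp
    then have "((\<lambda>z. (\<Prod>w\<leftarrow>ws. z - w) * g z) has_field_derivative
      (\<Prod>w\<leftarrow>ws. of_real x - w) * S x * g x + deriv g x * (\<Prod>w\<leftarrow>ws. of_real x - w)) (at (of_real x))"
      unfolding S_def by (intro DERIV_mult has_field_derivative_prod_list_diff xw)
    then have "deriv q x = (\<Prod>w\<leftarrow>ws. of_real x - w) * S x * g x + deriv g x * (\<Prod>w\<leftarrow>ws. of_real x - w)"
      unfolding g(2)[abs_def] by (rule DERIV_imp_deriv)
    then have "deriv q x / q x = S x + deriv g x / g x"
      using False gx by (simp add: g(2) field_simps)
    then have "cmod (deriv q x / q x) \<le> cmod (S x) + 12 * B"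
      using log_deriv_zero_free_bound[OF g(1,3,5) near[OF x]] B norm_triangle_ineq[of "S x" "deriv g x / g x"]
      by simp
    then have "sqrt (cmod (deriv q x / q x)) \<le> sqrt (cmod (S x) + 12 * B)" by simp
    also have "\<dots> \<le> sqrt (cmod (S x)) + sqrt (12 * B)"
      using B by (intro sqrt_add_le_add_sqrt) auto
    finally show ?thesis .
  qed (use B in simp)
  have "(\<integral>\<^sup>+x\<in>E. ennreal (sqrt (cmod (deriv q (of_real x) / q (of_real x)))) \<partial>lebesgue)
    \<le> (\<integral>\<^sup>+x. ennreal (sqrt (cmod (S x))) * indicator E x + ennreal (sqrt (12 * B)) * indicator E x \<partial>lebesgue)"
  proof (rule nn_integral_mono)
    fix x :: real
    show "ennreal (sqrt (cmod (deriv q (of_real x) / q (of_real x)))) * indicator E x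
      \<le> ennreal (sqrt (cmod (S x))) * indicator E x + ennreal (sqrt (12 * B)) * indicator E x"
    proof (cases "x \<in> E")
      case True
      then show ?thesis using le[of x] E(2) B
        by (auto simp: ennreal_plus[symmetric] simp del: ennreal_plus intro!: ennreal_leI)
    qed simp
  qed
  also have "\<dots> = (\<integral>\<^sup>+x\<in>E. ennreal (sqrt (cmod (S x))) \<partial>lebesgue) + ennreal (sqrt (12 * B)) * emeasure lebesgue E"
    by (subst nn_integral_add) (simp_all add: nn_integral_cmult_indicator)
  also have "\<dots> \<le> ennreal (50 * sqrt (B * m)) + ennreal (sqrt (12 * B)) * ennreal m"
    unfolding S_def m_def using E g(4) B lE by (intro add_mono sqrt_cauchy_sum_integral) (auto simp: emeasure_eq_measure2)
  also have "\<dots> = ennreal (50 * sqrt (B * m) + sqrt (12 * B) * m)"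
    using B m by (simp add: ennreal_mult''[symmetric] ennreal_plus[symmetric] del: ennreal_plus)
  also have "\<dots> \<le> ennreal (54 * sqrt (B * m))"
  proof (rule ennreal_leI)
    \<comment> \<open>Because |E| <= 1, the bounded error contributes a multiple of |E| <= sqrt |E|;
      with sqrt 12 <= 4 it raises the constant from 50 to 54.\<close>
    have "m \<le> sqrt m" using m by (intro real_le_rsqrt) (simp add: power2_eq_square mult_left_le)
    then have "sqrt (12 * B) * m \<le> sqrt (12 * B) * sqrt m" using B by (intro mult_left_mono) auto
    also have "\<dots> = sqrt 12 * sqrt (B * m)" by (simp add: real_sqrt_mult)
    also have "\<dots> \<le> 4 * sqrt (B * m)"
      using B m by (intro mult_right_mono real_le_lsqrt) auto
    finally show "50 * sqrt (B * m) + sqrt (12 * B) * m \<le> 54 * sqrt (B * m)" by simp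
  qed
  finally show "(\<integral>\<^sup>+x\<in>E. ennreal (sqrt (cmod (deriv q (of_real x) / q (of_real x)))) \<partial>lebesgue) \<le> ennreal (54 * sqrt (B * measure lebesgue E))"
    unfolding m_def .
qed

section \<open>Exponential polynomials\<close>

text \<open>Exponential polynomials as entire functions, so that zeros and growth off the real line
  can be used.\<close>

definition ep :: "complex set \<Rightarrow> (complex \<Rightarrow> complex) \<Rightarrow> complex \<Rightarrow> complex" where
  "ep L c z = (\<Sum>\<mu>\<in>L. c \<mu> * exp (\<mu> * z))"

text \<open>The coefficients of p' - \<nu> p. The operator kills the exponent \<nu> and keeps every
  other nonzero coefficient nonzero, so the order drops by exactly one.\<close>

definition shiftD :: "complex \<Rightarrow> (complex \<Rightarrow> complex) \<Rightarrow> complex \<Rightarrow> complex" where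
  "shiftD \<nu> c \<mu> = (\<mu> - \<nu>) * c \<mu>"

lemma ep_shiftD: "ep L (shiftD \<nu> c) z = (\<Sum>\<mu>\<in>L. \<mu> * c \<mu> * exp (\<mu> * z)) - \<nu> * ep L c z"
  unfolding ep_def shiftD_def by (simp add: sum_distrib_left sum_subtractf algebra_simps)

lemma ep_shiftD_remove:
  assumes "finite L"
  shows "ep (L - {\<nu>}) (shiftD \<nu> c) z = ep L (shiftD \<nu> c) z"
  unfolding ep_def using assms by (intro sum.mono_neutral_left) (auto simp: shiftD_def)

lemma has_field_derivative_ep:
  "(ep L c has_field_derivative ep L (shiftD \<nu> c) z + \<nu> * ep L c z) (at z)"
proof -
  have "((\<lambda>z. \<Sum>\<mu>\<in>L. c \<mu> * exp (\<mu> * z)) has_field_derivative (\<Sum>\<mu>\<in>L. \<mu> * c \<mu> * exp (\<mu> * z))) (at z)"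
    by (auto intro!: derivative_eq_intros sum.cong)
  then show ?thesis unfolding ep_shiftD by (simp add: ep_def[abs_def])
qed

lemma holomorphic_on_ep [holomorphic_intros]: "ep L c holomorphic_on S"
  by (meson has_field_derivative_ep field_differentiable_def field_differentiable_at_within holomorphic_on_def)

lemma continuous_on_ep: "continuous_on S (ep L c)"
  by (intro holomorphic_on_imp_continuous_on holomorphic_on_ep)

text \<open>Variation of constants for \<open>p' - \<nu> p = r\<close>, as a differential inequality.\<close>

lemma ep_bound_step:
  assumes Re: "Re (\<nu> * d) \<le> M" and A: "cmod (ep L c z0) \<le> A" and b: "b \<ge> 0"
    and r: "\<And>s::real. 0 \<le> s \<Longrightarrow> s \<le> 1 \<Longrightarrow>
        cmod d * cmod (ep L (shiftD \<nu> c) (z0 + of_real s * d)) \<le> A * b * exp (s * (M + b))"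
  shows "cmod (ep L c (z0 + d)) \<le> A * exp (M + b)"
proof -
  \<comment> \<open>The integrating factor turns p' - \<nu> p into an exact derivative along the
    segment from \<open>z0\<close> to \<open>z0 + d\<close>. The comparison function
    \<open>\<phi>\<close> starts at \<open>A\<close> and grows at rate \<open>a + b\<close>, where
    \<open>a\<close> is the slack between \<open>M\<close> and the real part of
    \<open>\<nu> * d\<close>.\<close>
  define F where "F s = exp (- \<nu> * d * of_real s) * ep L c (z0 + of_real s * d)" for s :: real
  define F' where "F' s = exp (- \<nu> * d * of_real s) * (d * ep L (shiftD \<nu> c) (z0 + of_real s * d))" for s :: real
  define a where "a = M - Re (\<nu> * d)"
  define \<phi> where "\<phi> s = A * exp (s * (a + b))" for s :: real
  have a: "a \<ge> 0" using Re by (simp add: a_def)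
  have A0: "A \<ge> 0" using A norm_ge_zero order_trans by blast
  have der: "(F has_vector_derivative F' s) (at s)" for s
  proof -
    have "((\<lambda>z. exp (- \<nu> * d * z) * ep L c (z0 + z * d)) has_field_derivative F' s) (at (of_real s))"
      unfolding F'_def
      by (auto intro!: derivative_eq_intros DERIV_chain2[OF has_field_derivative_ep[of _ _ \<nu>]] simp: algebra_simps)
    then show ?thesis unfolding F_def by (rule has_vector_derivative_real_field)
  qed
  have der\<phi>: "(\<phi> has_vector_derivative (a + b) * \<phi> s) (at s)" for s
    unfolding \<phi>_def has_real_derivative_iff_has_vector_derivative[symmetric]
    by (auto intro!: derivative_eq_intros)
  have "norm (F 1 - F 0) \<le> \<phi> 1 - \<phi> 0"
  proof (rule differentiable_bound_general[OF zero_less_one])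
    show "continuous_on {0..1} F" "continuous_on {0..1} \<phi>"
      using der der\<phi> by (meson continuous_at_imp_continuous_on has_vector_derivative_continuous)+
    fix s :: real assume s: "0 < s" "s < 1"
    have "norm (F' s) = exp (- (Re (\<nu> * d) * s)) * (cmod d * cmod (ep L (shiftD \<nu> c) (z0 + of_real s * d)))"
      unfolding F'_def norm_mult norm_exp_eq_Re by simp
    also have "\<dots> \<le> exp (- (Re (\<nu> * d) * s)) * (A * b * exp (s * (M + b)))"
      using s by (intro mult_left_mono r) auto
    also have "\<dots> = b * \<phi> s"
      by (simp add: \<phi>_def a_def exp_add[symmetric] algebra_simps exp_minus exp_diff)
    also have "\<dots> \<le> (a + b) * \<phi> s"
      using a A0 by (intro mult_right_mono) (auto simp: \<phi>_def)
    finally show "norm (F' s) \<le> (a + b) * \<phi> s" .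
  qed (rule der der\<phi>)+
  moreover have "norm (F 0) \<le> A" using A by (simp add: F_def)
  moreover have "\<phi> 0 = A" by (simp add: \<phi>_def)
  ultimately have "norm (F 1) \<le> \<phi> 1" using norm_triangle_sub[of "F 1" "F 0"] by simp
  moreover have "ep L c (z0 + d) = exp (\<nu> * d) * F 1"
    by (simp add: F_def mult_exp_exp flip: mult.assoc)
  ultimately have "cmod (ep L c (z0 + d)) \<le> exp (Re (\<nu> * d)) * \<phi> 1"
    unfolding norm_mult norm_exp_eq_Re by (metis (no_types) norm_mult norm_exp_eq_Re mult_left_mono exp_ge_zero)
  also have "\<dots> = A * exp (M + b)" by (simp add: \<phi>_def a_def exp_add exp_diff)
  finally show ?thesis .
qed

text \<open>Induction on the number of exponents. Cauchy's estimate on circles of radius \<delta>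
  bounds p' - \<nu> p on a disc smaller by \<delta>, which is why the initial disc has radius
  \<delta> times the order. The growth of the shorter polynomial is then integrated back.\<close>

lemma ep_growth:
  assumes "finite L" "\<And>\<mu>. \<mu> \<in> L \<Longrightarrow> cmod \<mu> \<le> \<Delta>" "\<delta> > 0" "\<Delta> \<ge> 0"
    and "\<And>w. cmod (w - z0) \<le> real (card L) * \<delta> \<Longrightarrow> cmod (ep L c w) \<le> A"
  shows "cmod (ep L c z) \<le> A * exp ((2 * \<Delta> + 1 / \<delta>) * cmod (z - z0))"
  using assms
proof (induction "card L" arbitrary: L c A z)
  case 0
  then have "L = {}" by simp
  with 0(6)[of z0] show ?case by (simp add: ep_def)
next
  case (Suc n)
  then obtain \<nu> where \<nu>: "\<nu> \<in> L" by (metis card.empty equals0I nat.distinct(1))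
  \<comment> \<open>The loss in passing to p' - \<nu> p: 1/\<delta> from Cauchy's estimate and
    \<Delta> from the term \<nu> p. Since \<Delta> + B is the exponent 2\<Delta> + 1/\<delta> of the
    claim, variation of constants reproduces the same growth rate.\<close>
  define B where "B = 1 / \<delta> + \<Delta>"
  have B0: "B \<ge> 0" using Suc.prems by (simp add: B_def)
  have cardL: "card (L - {\<nu>}) = n" "real (card L) = real n + 1"
    using Suc.hyps(2) \<nu> Suc.prems(1) by (auto simp flip: Suc.hyps(2))
  have A0: "cmod (ep L c z0) \<le> A" "A \<ge> 0"
    using Suc.prems(5)[of z0] Suc.prems(3) order_trans[OF norm_ge_zero[of "ep L c z0"]] by auto
  have "cmod (ep (L - {\<nu>}) (shiftD \<nu> c) w) \<le> A * B" if w: "cmod (w - z0) \<le> real (card (L - {\<nu>})) * \<delta>" for w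
  proof -
    have near: "cmod (ep L c x) \<le> A" if "cmod (w - x) \<le> \<delta>" for x
      using norm_triangle_ineq[of "x - w" "w - z0"] that w cardL
      by (intro Suc.prems(5)) (simp add: norm_minus_commute algebra_simps)
    have "cmod ((deriv ^^ 1) (ep L c) w) \<le> fact 1 * A / \<delta> ^ 1"
      using near \<open>\<delta> > 0\<close> by (intro Cauchy_inequality holomorphic_on_ep continuous_on_ep) auto
    then have "cmod (ep L (shiftD \<nu> c) w + \<nu> * ep L c w) \<le> A / \<delta>"
      using DERIV_imp_deriv[OF has_field_derivative_ep[of L c \<nu> w]] by simp
    moreover have "cmod (\<nu> * ep L c w) \<le> \<Delta> * A"
      unfolding norm_mult using near[of w] Suc.prems(2)[OF \<nu>] \<open>\<delta> > 0\<close> A0 \<open>\<Delta> \<ge> 0\<close> by (intro mult_mono) auto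
    ultimately have "cmod (ep L (shiftD \<nu> c) w) \<le> A / \<delta> + \<Delta> * A"
      using norm_triangle_sub[of "ep L (shiftD \<nu> c) w" "- (\<nu> * ep L c w)"] by simp
    then show ?thesis
      unfolding ep_shiftD_remove[OF Suc.prems(1)] by (simp add: B_def algebra_simps)
  qed
  then have IH: "cmod (ep L (shiftD \<nu> c) w) \<le> A * B * exp ((2 * \<Delta> + 1 / \<delta>) * cmod (w - z0))" for w
    using Suc.hyps(1)[of "L - {\<nu>}" "shiftD \<nu> c" "A * B" w] Suc.prems cardL
    unfolding ep_shiftD_remove[OF Suc.prems(1)] by auto
  have "cmod (ep L c (z0 + (z - z0))) \<le> A * exp (\<Delta> * cmod (z - z0) + B * cmod (z - z0))"
  proof (rule ep_bound_step[where \<nu>=\<nu>])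
    have "Re (\<nu> * (z - z0)) \<le> cmod \<nu> * cmod (z - z0)"
      by (metis complex_Re_le_cmod norm_mult)
    also have "\<dots> \<le> \<Delta> * cmod (z - z0)" using Suc.prems(2)[OF \<nu>] by (intro mult_right_mono) auto
    finally show "Re (\<nu> * (z - z0)) \<le> \<Delta> * cmod (z - z0)" .
    fix s :: real assume s: "0 \<le> s" "s \<le> 1"
    have "cmod (ep L (shiftD \<nu> c) (z0 + of_real s * (z - z0)))
      \<le> A * B * exp ((2 * \<Delta> + 1 / \<delta>) * (s * cmod (z - z0)))"
      using IH[of "z0 + of_real s * (z - z0)"] s by (simp add: norm_mult)
    then have "cmod (z - z0) * cmod (ep L (shiftD \<nu> c) (z0 + of_real s * (z - z0)))
      \<le> cmod (z - z0) * (A * B * exp ((2 * \<Delta> + 1 / \<delta>) * (s * cmod (z - z0))))"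
      by (intro mult_left_mono) auto
    also have "\<dots> = A * (B * cmod (z - z0)) * exp (s * (\<Delta> * cmod (z - z0) + B * cmod (z - z0)))"
      by (simp add: B_def algebra_simps)
    finally show "cmod (z - z0) * cmod (ep L (shiftD \<nu> c) (z0 + of_real s * (z - z0)))
      \<le> A * (B * cmod (z - z0)) * exp (s * (\<Delta> * cmod (z - z0) + B * cmod (z - z0)))" .
  qed (use A0 B0 in auto)
  then show ?case by (simp add: B_def algebra_simps)
qed

text \<open>The quotient is the logarithmic derivative of p(z) exp(-\<nu> z), whose exponents have
  modulus at most \<Delta>. Centred at a maximum point \<open>z0\<close> of its modulus on the unit
  disc about 1/2, this function grows by at most exp(34 W) over a disc of radius 16.\<close>

lemma ep_ratio_sqrt_integral:
  assumes L: "finite L" "\<nu> \<in> L" and c: "\<And>\<mu>. \<mu> \<in> L \<Longrightarrow> c \<mu> \<noteq> 0"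
    and \<Delta>: "\<And>\<mu>. \<mu> \<in> L \<Longrightarrow> cmod (\<mu> - \<nu>) \<le> \<Delta>" and W: "real (card L) + \<Delta> \<le> W"
  shows "finite {x::real. x \<in> {0..1} \<and> ep L c (of_real x) = 0}"
    and "\<lbrakk>E \<in> sets lebesgue; E \<subseteq> {0..1}\<rbrakk> \<Longrightarrow>
      (\<integral>\<^sup>+x\<in>E. ennreal (sqrt (cmod (ep L (shiftD \<nu> c) (of_real x) / ep L c (of_real x)))) \<partial>lebesgue) \<le> ennreal (324 * sqrt (W * measure lebesgue E))"
proof -
  define n where "n = card L"
  have n: "n > 0" using L by (auto simp: n_def card_gt_0_iff)
  have \<Delta>0: "\<Delta> \<ge> 0" using \<Delta>[OF L(2)] by simp
  define L' where "L' = (\<lambda>\<mu>. \<mu> - \<nu>) ` L"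
  have inj: "inj_on (\<lambda>\<mu>. \<mu> - \<nu>) L" by (auto simp: inj_on_def)
  have cardL': "card L' = n" "finite L'" using L inj by (auto simp: L'_def n_def card_image)
  define q where "q = ep L' (\<lambda>\<mu>. c (\<mu> + \<nu>))"
  have q_eq: "q z = ep L c z * exp (- \<nu> * z)" for z
    unfolding q_def ep_def L'_def sum.reindex[OF inj] o_def sum_distrib_right
    by (intro sum.cong) (simp_all add: mult_exp_exp algebra_simps)
  have hol: "q holomorphic_on UNIV" unfolding q_def by (rule holomorphic_on_ep)
  have "continuous_on (cball (1/2) 1) (\<lambda>z. cmod (q z))"
    by (intro continuous_intros holomorphic_on_imp_continuous_on holomorphic_on_subset[OF hol]) auto
  then obtain z0 where z0: "z0 \<in> cball (1/2) 1" and max: "\<And>z. z \<in> cball (1/2) 1 \<Longrightarrow> cmod (q z) \<le> cmod (q z0)"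
    using continuous_attains_sup[of "cball (1/2::complex) 1" "\<lambda>z. cmod (q z)"] by auto
  \<comment> \<open>With \<delta> = 1/n the disc demanded by \<open>ep_growth\<close> has radius
    exactly 1, the disc on which \<open>z0\<close> maximises the modulus.\<close>
  have growth: "cmod (q z) \<le> cmod (q z0) * exp ((2 * \<Delta> + 1 / (1 / real n)) * cmod (z - 1/2))" for z
    unfolding q_def
    by (rule ep_growth[OF cardL'(2)])
       (use \<Delta> \<Delta>0 n cardL' max in \<open>auto simp: L'_def q_def dist_norm norm_minus_commute\<close>)
  \<comment> \<open>A vanishing maximum would force \<open>q\<close>, hence the exponential
    polynomial, to vanish identically, against the independence of exponentials.\<close>
  have q0: "q z0 \<noteq> 0"
  proof
    assume "q z0 = 0"
    then have "q z = 0" for z using growth[of z] by simp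
    then have "ep L c z = 0" for z using q_eq[of z] by simp
    then have "\<forall>\<mu>\<in>L. c \<mu> = 0" unfolding ep_def by (intro exponentials_independent L) auto
    then show False using c L by auto
  qed
  have z0': "cmod (z0 - 1/2) \<le> 1" using z0 by (auto simp: dist_norm norm_minus_commute)
  have W1: "W \<ge> 1" using W n \<Delta>0 by (simp add: n_def)
  have bound: "cmod (q z) \<le> exp (34 * W) * cmod (q z0)" if "cmod (z - z0) \<le> 16" for z
  proof -
    have "cmod (z - 1/2) \<le> 17" using norm_triangle_ineq[of "z - z0" "z0 - 1/2"] that z0' by simp
    then have "(2 * \<Delta> + real n) * cmod (z - 1/2) \<le> (2 * W) * 17"
      using W n \<Delta>0 by (intro mult_mono) (auto simp: n_def)
    then have "cmod (q z0) * exp ((2 * \<Delta> + real n) * cmod (z - 1/2)) \<le> cmod (q z0) * exp (34 * W)"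
      by (intro mult_left_mono) auto
    with growth[of z] show ?thesis by (simp add: mult.commute)
  qed
  have "34 * W \<ge> 1" using W1 by simp
  note main = log_deriv_sqrt_integral[OF hol q0 z0' bound this]
  show "finite {x::real. x \<in> {0..1} \<and> ep L c (of_real x) = 0}"
    using main(1) unfolding q_eq by simp
  have dq: "deriv q z / q z = ep L (shiftD \<nu> c) z / ep L c z" for z
  proof -
    have "((\<lambda>z. ep L c z * exp (- \<nu> * z)) has_field_derivative ep L (shiftD \<nu> c) z * exp (- \<nu> * z)) (at z)"
      by (auto intro!: derivative_eq_intros has_field_derivative_ep[of _ _ \<nu>] simp: algebra_simps)
    then have "deriv q z = ep L (shiftD \<nu> c) z * exp (- \<nu> * z)"
      unfolding q_eq[abs_def] by (rule DERIV_imp_deriv)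
    then show ?thesis by (simp add: q_eq)
  qed
  assume E: "E \<in> sets lebesgue" "E \<subseteq> {0..1}"
  have "54 * sqrt (34 * W * measure lebesgue E) \<le> 324 * sqrt (W * measure lebesgue E)"
  proof -
    have "sqrt 34 * sqrt (W * measure lebesgue E) \<le> 6 * sqrt (W * measure lebesgue E)"
      using W1 by (intro mult_right_mono real_le_lsqrt) auto
    then show ?thesis by (simp add: real_sqrt_mult mult_ac)
  qed
  then show "(\<integral>\<^sup>+x\<in>E. ennreal (sqrt (cmod (ep L (shiftD \<nu> c) (of_real x) / ep L c (of_real x)))) \<partial>lebesgue) \<le> ennreal (324 * sqrt (W * measure lebesgue E))"
    using main(2)[OF _ E] unfolding dq by (meson ennreal_leI order_trans)
qed

section \<open>Removing the exponents\<close>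

text \<open>The dependence on \<open>|E|\<close> makes this a quantitative weak \<open>L\<^sup>1\<close> condition.\<close>

definition weak_type :: "(real \<Rightarrow> real) \<Rightarrow> bool" where
  "weak_type f \<longleftrightarrow> f \<in> borel_measurable lebesgue \<and> (\<forall>x. f x \<ge> 0) \<and>
     (\<forall>E. E \<in> sets lebesgue \<longrightarrow> E \<subseteq> {0..1} \<longrightarrow>
        (\<integral>\<^sup>+x\<in>E. ennreal (sqrt (f x)) \<partial>lebesgue) \<le> ennreal (600 * sqrt (measure lebesgue E)))"

text \<open>Dividing by a scale \<open>D\<close> comparable to order plus spread makes the constant
  absolute: 324 sqrt 3 < 600. Below, \<open>D\<close> is either the fixed bound \<open>N\<close> or
  the spread \<Delta> > N.\<close>

lemma weak_type_ratio:
  assumes L: "finite L" "\<nu> \<in> L" and c: "\<And>\<mu>. \<mu> \<in> L \<Longrightarrow> c \<mu> \<noteq> 0"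
    and \<Delta>: "\<And>\<mu>. \<mu> \<in> L \<Longrightarrow> cmod (\<mu> - \<nu>) \<le> \<Delta>" and D: "real (card L) + \<Delta> \<le> 3 * D" "D > 0"
  shows "weak_type (\<lambda>x. cmod (ep L (shiftD \<nu> c) (of_real x) / ep L c (of_real x)) / D)"
  unfolding weak_type_def
proof (intro conjI allI impI)
  have [measurable]: "(\<lambda>x::real. ep L c (of_real x)) \<in> borel_measurable borel" for c
    by (intro borel_measurable_continuous_onI continuous_on_compose2[OF continuous_on_ep] continuous_intros) auto
  have m [measurable]: "(\<lambda>x. cmod (ep L (shiftD \<nu> c) (of_real x) / ep L c (of_real x))) \<in> borel_measurable lebesgue"
    by (rule borel_measurable_lebesgueI) measurable
  then show "(\<lambda>x. cmod (ep L (shiftD \<nu> c) (of_real x) / ep L c (of_real x)) / D) \<in> borel_measurable lebesgue"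
    by measurable
  show "0 \<le> cmod (ep L (shiftD \<nu> c) (of_real x) / ep L c (of_real x)) / D" for x :: real
    using D by simp
  fix E :: "real set" assume E: "E \<in> sets lebesgue" "E \<subseteq> {0..1}"
  note [measurable] = E(1)
  have "(\<integral>\<^sup>+x\<in>E. ennreal (sqrt (cmod (ep L (shiftD \<nu> c) (of_real x) / ep L c (of_real x)) / D)) \<partial>lebesgue)
    = (\<integral>\<^sup>+x. ennreal (1 / sqrt D) * (ennreal (sqrt (cmod (ep L (shiftD \<nu> c) (of_real x) / ep L c (of_real x)))) * indicator E x) \<partial>lebesgue)"
    using D by (intro nn_integral_cong) (auto simp: real_sqrt_divide ennreal_mult''[symmetric] split: split_indicator)
  also have "\<dots> = ennreal (1 / sqrt D) * (\<integral>\<^sup>+x\<in>E. ennreal (sqrt (cmod (ep L (shiftD \<nu> c) (of_real x) / ep L c (of_real x)))) \<partial>lebesgue)"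
    by (rule nn_integral_cmult) measurable
  also have "\<dots> \<le> ennreal (1 / sqrt D) * ennreal (324 * sqrt (3 * D * measure lebesgue E))"
    by (intro mult_left_mono ep_ratio_sqrt_integral(2)[OF L c \<Delta> D(1) E]) auto
  also have "\<dots> = ennreal (324 * sqrt 3 * sqrt (measure lebesgue E))"
    using D by (subst ennreal_mult''[symmetric]) (auto simp: real_sqrt_mult field_simps)
  also have "\<dots> \<le> ennreal (600 * sqrt (measure lebesgue E))"
  proof (intro ennreal_leI mult_right_mono)
    have "sqrt 3 \<le> 1.8" by (rule real_le_lsqrt) (auto simp: power2_eq_square)
    then show "324 * sqrt 3 \<le> 600" by simp
  qed simp
  finally show "(\<integral>\<^sup>+x\<in>E. ennreal (sqrt (cmod (ep L (shiftD \<nu> c) (of_real x) / ep L c (of_real x)) / D)) \<partial>lebesgue)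
    \<le> ennreal (600 * sqrt (measure lebesgue E))" .
qed

lemma prod_list_one_plus_ge_1:
  fixes f :: "'a \<Rightarrow> real"
  assumes "\<And>x. x \<in> set xs \<Longrightarrow> f x \<ge> 0"
  shows "1 \<le> (\<Prod>x\<leftarrow>xs. 1 + f x)"
  using assms
proof (induction xs)
  case (Cons a xs)
  then have "1 * 1 \<le> (1 + f a) * (\<Prod>x\<leftarrow>xs. 1 + f x)" by (intro mult_mono) auto
  then show ?case by simp
qed simp

text \<open>One exponent is removed per step, and variation of constants from \<open>t0\<close>
  recovers p from p' - \<nu> p. The ratio at \<open>t0\<close> costs a factor \<open>N\<close>, but
  integrating N exp(N |s - t0|) regains it, so the rate \<open>M + N\<close> is the same at every
  stage and does not accumulate.\<close>

lemma ep_chain_small_spread: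
  assumes "finite L" "L \<noteq> {}" "\<And>\<mu>. \<mu> \<in> L \<Longrightarrow> c \<mu> \<noteq> 0"
    and "\<And>\<mu>. \<mu> \<in> L \<Longrightarrow> \<bar>Re \<mu>\<bar> \<le> M"
    and "\<And>\<mu> \<nu>. \<mu> \<in> L \<Longrightarrow> \<nu> \<in> L \<Longrightarrow> cmod (\<mu> - \<nu>) \<le> N" and "real (card L) \<le> 2 * N" "N > 0"
  shows "\<exists>fs Z. length fs = card L - 1 \<and> (\<forall>f\<in>set fs. weak_type f) \<and> finite Z \<and>
    (\<forall>t\<in>{0..1}. \<forall>t0\<in>{0..1} - Z. cmod (ep L c (of_real t)) \<le>
        exp ((M + N) * \<bar>t - t0\<bar>) * (\<Prod>f\<leftarrow>fs. 1 + f t0) * cmod (ep L c (of_real t0)))"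
  using assms
proof (induction "card L" arbitrary: L c)
  case 0
  then show ?case by simp
next
  case (Suc n)
  obtain \<nu> where \<nu>: "\<nu> \<in> L" using Suc.prems by auto
  define L' where "L' = L - {\<nu>}"
  define c' where "c' = shiftD \<nu> c"
  have cardL': "card L' = n" unfolding L'_def using Suc.hyps(2) \<nu> Suc.prems(1) by simp
  have ep': "ep L' c' z = ep L (shiftD \<nu> c) z" for z
    unfolding L'_def c'_def by (rule ep_shiftD_remove[OF Suc.prems(1)])
  define f where "f = (\<lambda>x::real. cmod (ep L (shiftD \<nu> c) (of_real x) / ep L c (of_real x)) / N)"
  \<comment> \<open>At a zero of the exponential polynomial the quotient in \<open>f\<close> takes
    the default value 0 and \<open>fZ\<close> may fail, so these finitely many points join the
    exceptional set.\<close>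
  define Z0 where "Z0 = {x::real. x \<in> {0..1} \<and> ep L c (of_real x) = 0}"
  have Z0: "finite Z0"
    unfolding Z0_def using Suc.prems(5)[OF _ \<nu>]
    by (intro ep_ratio_sqrt_integral(1)[OF Suc.prems(1) \<nu> Suc.prems(3) _ order_refl])
  have wf: "weak_type f"
    unfolding f_def using Suc.prems \<nu> by (intro weak_type_ratio[where \<Delta>=N]) auto
  have f0: "f x \<ge> 0" for x using wf by (auto simp: weak_type_def)
  have fZ: "cmod (ep L' c' (of_real t0)) = N * f t0 * cmod (ep L c (of_real t0))" if "t0 \<in> {0..1} - Z0" for t0
    using that \<open>N > 0\<close> by (auto simp: ep' f_def norm_divide Z0_def)
  \<comment> \<open>Variation of constants with b = N |t - t0|, on either side of
    \<open>t0\<close>.\<close>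
  have step: "cmod (ep L c (of_real t)) \<le> A * exp ((M + N) * \<bar>t - t0\<bar>)"
    if A: "cmod (ep L c (of_real t0)) \<le> A"
      and r: "\<And>s. s \<in> closed_segment t0 t \<Longrightarrow> cmod (ep L' c' (of_real s)) \<le> A * N * exp ((M + N) * \<bar>s - t0\<bar>)" for t t0 A
  proof -
    have "cmod (ep L c (of_real t0 + of_real (t - t0))) \<le> A * exp (M * \<bar>t - t0\<bar> + N * \<bar>t - t0\<bar>)"
    proof (rule ep_bound_step[where \<nu>=\<nu>])
      have "Re (\<nu> * of_real (t - t0)) \<le> \<bar>Re \<nu>\<bar> * \<bar>t - t0\<bar>"
        by (simp flip: abs_mult)
      also have "\<dots> \<le> M * \<bar>t - t0\<bar>" using Suc.prems(4)[OF \<nu>] by (intro mult_right_mono) auto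
      finally show "Re (\<nu> * of_real (t - t0)) \<le> M * \<bar>t - t0\<bar>" .
      fix s :: real assume s: "0 \<le> s" "s \<le> 1"
      have "t0 + s * (t - t0) \<in> closed_segment t0 t"
        using s by (auto simp: closed_segment_def algebra_simps intro!: exI[of _ s])
      from r[OF this] have "cmod (ep L (shiftD \<nu> c) (of_real t0 + of_real s * of_real (t - t0)))
          \<le> A * N * exp ((M + N) * (s * \<bar>t - t0\<bar>))"
        using s by (simp add: ep' abs_mult)
      then have "\<bar>t - t0\<bar> * cmod (ep L (shiftD \<nu> c) (of_real t0 + of_real s * of_real (t - t0)))
          \<le> \<bar>t - t0\<bar> * (A * N * exp ((M + N) * (s * \<bar>t - t0\<bar>)))"
        by (intro mult_left_mono) auto
      then show "cmod (of_real (t - t0)) * cmod (ep L (shiftD \<nu> c) (of_real t0 + of_real s * of_real (t - t0)))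
          \<le> A * (N * \<bar>t - t0\<bar>) * exp (s * (M * \<bar>t - t0\<bar> + N * \<bar>t - t0\<bar>))"
        unfolding norm_of_real by (simp add: algebra_simps)
    qed (use A \<open>N > 0\<close> in auto)
    then show ?thesis by (simp add: algebra_simps)
  qed
  show ?case
  proof (cases "n = 0")
    case True
    then have "L' = {}" using cardL' Suc.prems(1) by (simp add: L'_def)
    then have "ep L' c' z = 0" for z by (simp add: ep_def)
    then have "cmod (ep L c (of_real t)) \<le> cmod (ep L c (of_real t0)) * exp ((M + N) * \<bar>t - t0\<bar>)" for t t0
      using \<open>N > 0\<close> by (intro step) auto
    then show ?thesis using True Suc.hyps(2)
      by (intro exI[of _ "[]"] exI[of _ "{}"]) (auto simp: mult.commute)
  next
    case False
    have "\<exists>fs Z. length fs = card L' - 1 \<and> (\<forall>f\<in>set fs. weak_type f) \<and> finite Z \<and>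
      (\<forall>t\<in>{0..1}. \<forall>t0\<in>{0..1} - Z. cmod (ep L' c' (of_real t)) \<le>
        exp ((M + N) * \<bar>t - t0\<bar>) * (\<Prod>f\<leftarrow>fs. 1 + f t0) * cmod (ep L' c' (of_real t0)))"
    proof (rule Suc.hyps(1))
      show "L' \<noteq> {}" using False cardL' by auto
      show "real (card L') \<le> 2 * N" using Suc.prems(6) cardL' Suc.hyps(2) by linarith
      show "c' \<mu> \<noteq> 0" if "\<mu> \<in> L'" for \<mu> using that Suc.prems(3) by (auto simp: c'_def L'_def shiftD_def)
    qed (use Suc.prems cardL' in \<open>auto simp: L'_def\<close>)
    then obtain fs Z where fs: "length fs = card L' - 1" "\<forall>f\<in>set fs. weak_type f" "finite Z"
      and IH: "\<And>t t0. t \<in> {0..1} \<Longrightarrow> t0 \<in> {0..1} - Z \<Longrightarrow> cmod (ep L' c' (of_real t)) \<le>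
        exp ((M + N) * \<bar>t - t0\<bar>) * (\<Prod>f\<leftarrow>fs. 1 + f t0) * cmod (ep L' c' (of_real t0))"
      by blast
    have "cmod (ep L c (of_real t)) \<le>
        exp ((M + N) * \<bar>t - t0\<bar>) * (\<Prod>f\<leftarrow>f # fs. 1 + f t0) * cmod (ep L c (of_real t0))"
      if t: "t \<in> {0..1}" and t0: "t0 \<in> {0..1} - (Z \<union> Z0)" for t t0
    proof -
      define P where "P = (\<Prod>f\<leftarrow>fs. 1 + f t0)"
      have P: "P \<ge> 1" unfolding P_def using fs(2) by (intro prod_list_one_plus_ge_1) (auto simp: weak_type_def)
      define A where "A = (1 + f t0) * P * cmod (ep L c (of_real t0))"
      have "1 * 1 \<le> (1 + f t0) * P" using P f0[of t0] by (intro mult_mono) auto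
      then have A1: "cmod (ep L c (of_real t0)) \<le> A"
        unfolding A_def by (simp add: mult_le_cancel_right1)
      have "cmod (ep L c (of_real t)) \<le> A * exp ((M + N) * \<bar>t - t0\<bar>)"
      proof (rule step[OF A1])
        fix s assume "s \<in> closed_segment t0 t"
        then have s: "s \<in> {0..1}" using t t0 by (auto simp: closed_segment_eq_real_ivl split: if_splits)
        have "cmod (ep L' c' (of_real s)) \<le> exp ((M + N) * \<bar>s - t0\<bar>) * P * (N * f t0 * cmod (ep L c (of_real t0)))"
          using IH[OF s, of t0] t0 fZ[of t0] by (simp add: P_def)
        also have "\<dots> = (f t0 * P * cmod (ep L c (of_real t0))) * N * exp ((M + N) * \<bar>s - t0\<bar>)"
          by (simp add: mult_ac)
        also have "\<dots> \<le> A * N * exp ((M + N) * \<bar>s - t0\<bar>)"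
          unfolding A_def using P \<open>N > 0\<close> by (intro mult_right_mono) auto
        finally show "cmod (ep L' c' (of_real s)) \<le> A * N * exp ((M + N) * \<bar>s - t0\<bar>)" .
      qed
      then show ?thesis by (simp add: A_def P_def mult_ac)
    qed
    then show ?thesis
      using fs wf Z0 False cardL' Suc.hyps(2)
      by (intro exI[of _ "f # fs"] exI[of _ "Z \<union> Z0"]) auto
  qed
qed

text \<open>While two exponents are more than \<open>N\<close> apart, removing a suitable one costs
  only a factor 2 and no exponential. Once the spread is at most \<open>N\<close>, the previous
  lemma finishes with |t - t0| <= 1.\<close>

lemma ep_chain:
  assumes "finite L" "L \<noteq> {}" "\<And>\<mu>. \<mu> \<in> L \<Longrightarrow> c \<mu> \<noteq> 0"
    and "\<And>\<mu>. \<mu> \<in> L \<Longrightarrow> \<bar>Re \<mu>\<bar> \<le> M" and "real (card L) \<le> 2 * N" "N > 0"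
  shows "\<exists>fs Z. length fs = card L - 1 \<and> (\<forall>f\<in>set fs. weak_type f) \<and> finite Z \<and>
    (\<forall>t\<in>{0..1}. \<forall>t0\<in>{0..1} - Z. cmod (ep L c (of_real t)) \<le>
        2 ^ (card L - 1) * exp (M + N) * (\<Prod>f\<leftarrow>fs. 1 + f t0) * cmod (ep L c (of_real t0)))"
  using assms
proof (induction "card L" arbitrary: L c)
  case 0
  then show ?case by simp
next
  case (Suc n)
  have M0: "M \<ge> 0" using Suc.prems(2,4) by fastforce
  show ?case
  proof (cases "\<forall>\<mu>\<in>L. \<forall>\<nu>\<in>L. cmod (\<mu> - \<nu>) \<le> N")
    case True
    then have spread: "cmod (\<mu> - \<nu>) \<le> N" if "\<mu> \<in> L" "\<nu> \<in> L" for \<mu> \<nu> using that by blast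
    have "\<exists>fs Z. length fs = card L - 1 \<and> (\<forall>f\<in>set fs. weak_type f) \<and> finite Z \<and>
      (\<forall>t\<in>{0..1}. \<forall>t0\<in>{0..1} - Z. cmod (ep L c (of_real t)) \<le>
        exp ((M + N) * \<bar>t - t0\<bar>) * (\<Prod>f\<leftarrow>fs. 1 + f t0) * cmod (ep L c (of_real t0)))"
      by (rule ep_chain_small_spread) (use Suc.prems spread in auto)
    then obtain fs Z where fs: "length fs = card L - 1" "\<forall>f\<in>set fs. weak_type f" "finite Z"
      and small: "\<And>t t0. t \<in> {0..1} \<Longrightarrow> t0 \<in> {0..1} - Z \<Longrightarrow> cmod (ep L c (of_real t)) \<le>
        exp ((M + N) * \<bar>t - t0\<bar>) * (\<Prod>f\<leftarrow>fs. 1 + f t0) * cmod (ep L c (of_real t0))"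
      by blast
    have "cmod (ep L c (of_real t)) \<le>
        2 ^ (card L - 1) * exp (M + N) * (\<Prod>f\<leftarrow>fs. 1 + f t0) * cmod (ep L c (of_real t0))"
      if t: "t \<in> {0..1}" and t0: "t0 \<in> {0..1} - Z" for t t0
    proof -
      have P: "1 \<le> (\<Prod>f\<leftarrow>fs. 1 + f t0)"
        using fs(2) by (intro prod_list_one_plus_ge_1) (auto simp: weak_type_def)
      have "(M + N) * \<bar>t - t0\<bar> \<le> (M + N) * 1"
        using M0 \<open>N > 0\<close> t t0 by (intro mult_left_mono) auto
      then have "1 * exp ((M + N) * \<bar>t - t0\<bar>) \<le> 2 ^ (card L - 1) * exp (M + N)"
        by (intro mult_mono) auto
      then have "exp ((M + N) * \<bar>t - t0\<bar>) * ((\<Prod>f\<leftarrow>fs. 1 + f t0) * cmod (ep L c (of_real t0)))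
        \<le> 2 ^ (card L - 1) * exp (M + N) * ((\<Prod>f\<leftarrow>fs. 1 + f t0) * cmod (ep L c (of_real t0)))"
        using P by (intro mult_right_mono) auto
      with small[OF t t0] show ?thesis by (simp add: mult.assoc)
    qed
    then show ?thesis using fs by (intro exI[of _ fs] exI[of _ Z]) auto
  next
    case False
    define Dset where "Dset = (\<lambda>(\<mu>, \<nu>). cmod (\<mu> - \<nu>)) ` (L \<times> L)"
    define \<Delta> where "\<Delta> = Max Dset"
    have Dset: "finite Dset" "Dset \<noteq> {}" using Suc.prems(1,2) by (auto simp: Dset_def)
    have \<Delta>_ge: "cmod (\<mu> - \<nu>) \<le> \<Delta>" if "\<mu> \<in> L" "\<nu> \<in> L" for \<mu> \<nu>
      unfolding \<Delta>_def using Dset that by (intro Max_ge) (auto simp: Dset_def)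
    have \<Delta>N: "\<Delta> > N" using False \<Delta>_ge by force
    have "\<Delta> \<in> Dset" unfolding \<Delta>_def using Dset by (rule Max_in)
    then obtain \<mu>1 \<mu>2 where mu: "\<mu>1 \<in> L" "\<mu>2 \<in> L" "cmod (\<mu>1 - \<mu>2) = \<Delta>" by (auto simp: Dset_def)
    have "continuous_on {0..1} (\<lambda>t::real. cmod (ep L c (of_real t)))"
      by (intro continuous_intros continuous_on_compose2[OF continuous_on_ep]) auto
    then obtain ts where ts: "ts \<in> {0..1}"
      and max: "\<And>t. t \<in> {0..1} \<Longrightarrow> cmod (ep L c (of_real t)) \<le> cmod (ep L c (of_real ts))"
      using continuous_attains_sup[of "{0..1::real}" "\<lambda>t. cmod (ep L c (of_real t))"] by auto
    \<comment> \<open>At the maximum point \<open>ts\<close> the two candidate derivatives differ by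
      (\<mu>1 - \<mu>2) p, so the larger one has modulus at least \<Delta>/2 times the maximum of
      |p|.\<close>
    have "ep L (shiftD \<mu>2 c) (of_real ts) - ep L (shiftD \<mu>1 c) (of_real ts) = (\<mu>1 - \<mu>2) * ep L c (of_real ts)"
      unfolding ep_shiftD by (simp add: algebra_simps)
    then have "\<Delta> * cmod (ep L c (of_real ts)) \<le> cmod (ep L (shiftD \<mu>2 c) (of_real ts)) + cmod (ep L (shiftD \<mu>1 c) (of_real ts))"
      by (metis mu(3) norm_mult norm_triangle_ineq4)
    then obtain \<nu> where \<nu>: "\<nu> \<in> L" and big: "\<Delta> * cmod (ep L c (of_real ts)) \<le> 2 * cmod (ep L (shiftD \<nu> c) (of_real ts))"
      using mu(1,2) by (cases "cmod (ep L (shiftD \<mu>2 c) (of_real ts)) \<le> cmod (ep L (shiftD \<mu>1 c) (of_real ts))") fastforce+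
    define L' where "L' = L - {\<nu>}"
    define c' where "c' = shiftD \<nu> c"
    have cardL': "card L' = n" unfolding L'_def using Suc.hyps(2) \<nu> Suc.prems(1) by simp
    have ep': "ep L' c' z = ep L (shiftD \<nu> c) z" for z
      unfolding L'_def c'_def by (rule ep_shiftD_remove[OF Suc.prems(1)])
    have ne: "L' \<noteq> {}"
    proof
      assume "L' = {}"
      then have "\<mu>1 = \<mu>2" using mu by (auto simp: L'_def)
      then show False using mu(3) \<Delta>N \<open>N > 0\<close> by simp
    qed
    have "\<exists>fs Z. length fs = card L' - 1 \<and> (\<forall>f\<in>set fs. weak_type f) \<and> finite Z \<and>
      (\<forall>t\<in>{0..1}. \<forall>t0\<in>{0..1} - Z. cmod (ep L' c' (of_real t)) \<le>
        2 ^ (card L' - 1) * exp (M + N) * (\<Prod>f\<leftarrow>fs. 1 + f t0) * cmod (ep L' c' (of_real t0)))"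
    proof (rule Suc.hyps(1))
      show "real (card L') \<le> 2 * N" using Suc.prems(5) cardL' Suc.hyps(2) by linarith
      show "c' \<mu> \<noteq> 0" if "\<mu> \<in> L'" for \<mu> using that Suc.prems(3) by (auto simp: c'_def L'_def shiftD_def)
    qed (use Suc.prems cardL' ne in \<open>auto simp: L'_def\<close>)
    then obtain fs Z where fs: "length fs = card L' - 1" "\<forall>f\<in>set fs. weak_type f" "finite Z"
      and IH: "\<And>t t0. t \<in> {0..1} \<Longrightarrow> t0 \<in> {0..1} - Z \<Longrightarrow> cmod (ep L' c' (of_real t)) \<le>
        2 ^ (card L' - 1) * exp (M + N) * (\<Prod>f\<leftarrow>fs. 1 + f t0) * cmod (ep L' c' (of_real t0))"
      by blast
    define f where "f = (\<lambda>x::real. cmod (ep L (shiftD \<nu> c) (of_real x) / ep L c (of_real x)) / \<Delta>)"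
    define Z0 where "Z0 = {x::real. x \<in> {0..1} \<and> ep L c (of_real x) = 0}"
    have Z0: "finite Z0"
      unfolding Z0_def using \<Delta>_ge[OF _ \<nu>]
      by (intro ep_ratio_sqrt_integral(1)[OF Suc.prems(1) \<nu> Suc.prems(3) _ order_refl])
    have wf: "weak_type f"
      unfolding f_def using Suc.prems \<nu> \<Delta>_ge \<Delta>N by (intro weak_type_ratio[where \<Delta>=\<Delta>]) auto
    have f0: "f x \<ge> 0" for x using wf by (auto simp: weak_type_def)
    have fZ: "cmod (ep L' c' (of_real t0)) = \<Delta> * f t0 * cmod (ep L c (of_real t0))" if "t0 \<in> {0..1} - Z0" for t0
      using that \<Delta>N \<open>N > 0\<close> by (auto simp: ep' f_def norm_divide Z0_def)
    have "cmod (ep L c (of_real t)) \<le>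
        2 ^ (card L - 1) * exp (M + N) * (\<Prod>f\<leftarrow>f # fs. 1 + f t0) * cmod (ep L c (of_real t0))"
      if t: "t \<in> {0..1}" and t0: "t0 \<in> {0..1} - (Z \<union> Z0)" for t t0
    proof -
      define P where "P = (\<Prod>f\<leftarrow>fs. 1 + f t0)"
      have P: "P \<ge> 1" unfolding P_def using fs(2) by (intro prod_list_one_plus_ge_1) (auto simp: weak_type_def)
      define K where "K = 2 ^ (card L' - 1) * exp (M + N)"
      have K0: "K \<ge> 0" by (simp add: K_def)
      \<comment> \<open>As \<open>L'\<close> is nonempty, the truncated exponent
        \<open>card L - 1\<close> is one more than \<open>card L' - 1\<close>; the extra 2 pays for
        this removal.\<close>
      have pow: "2 ^ (card L - 1) * exp (M + N) = 2 * K"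
        using ne cardL' Suc.hyps(2) Suc.prems(1)
        by (cases n) (auto simp: K_def L'_def simp flip: Suc.hyps(2))
      \<comment> \<open>The path is from \<open>t\<close> to the maximum point \<open>ts\<close>,
        from there to \<open>t0\<close> for the shorter polynomial, and back to p through the ratio
        \<open>f\<close>; the gained \<Delta> cancels the normalisation of \<open>f\<close>.\<close>
      have "\<Delta> * cmod (ep L c (of_real t)) \<le> \<Delta> * cmod (ep L c (of_real ts))"
        using max[OF t] \<Delta>N \<open>N > 0\<close> by (intro mult_left_mono) auto
      also have "\<dots> \<le> 2 * cmod (ep L' c' (of_real ts))" using big by (simp add: ep')
      also have "\<dots> \<le> 2 * (K * P * (\<Delta> * f t0 * cmod (ep L c (of_real t0))))"
        using IH[OF ts, of t0] t0 fZ[of t0] by (simp add: P_def K_def)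
      also have "\<dots> = \<Delta> * (2 * K * (f t0 * P) * cmod (ep L c (of_real t0)))" by (simp add: mult_ac)
      finally have "cmod (ep L c (of_real t)) \<le> 2 * K * (f t0 * P) * cmod (ep L c (of_real t0))"
        using \<Delta>N \<open>N > 0\<close> by (simp add: mult_le_cancel_left_pos)
      also have "\<dots> \<le> 2 * K * ((1 + f t0) * P) * cmod (ep L c (of_real t0))"
        using P K0 f0 by (intro mult_right_mono mult_left_mono) auto
      finally show ?thesis unfolding pow by (simp add: P_def mult_ac)
    qed
    moreover have "n \<noteq> 0" using ne cardL' Suc.prems(1) by (auto simp: L'_def)
    ultimately show ?thesis
      using fs wf Z0 cardL' Suc.hyps(2)
      by (intro exI[of _ "f # fs"] exI[of _ "Z \<union> Z0"]) auto
  qed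
qed

section \<open>A good point in a set of positive measure\<close>

text \<open>The sum of the square roots has mean at most 600 d / sqrt |E| over \<open>E\<close>, so
  some point outside the null set \<open>Z\<close> stays below twice that. There the product of 1 +
  f <= (1 + sqrt f)^2 is controlled by the inequality of the means.\<close>

lemma weak_type_point:
  assumes fs: "\<forall>f\<in>set fs. weak_type f" and Z: "finite Z"
    and E: "E \<in> sets lebesgue" "E \<subseteq> {0..1}" "measure lebesgue E > 0"
  shows "\<exists>t\<in>E - Z. (\<Prod>f\<leftarrow>fs. 1 + f t) \<le> (1500000 / measure lebesgue E) ^ length fs"
proof -
  define m where "m = measure lebesgue E"
  define d where "d = length fs"
  define S where "S t = (\<Sum>f\<leftarrow>fs. sqrt (f t))" for t
  note [measurable] = E(1)
  have lE: "E \<in> lmeasurable" using E by (intro bounded_set_imp_lmeasurable) (auto intro: bounded_subset[OF bounded_closed_interval])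
  have emE: "emeasure lebesgue E = ennreal m" using lE by (simp add: m_def emeasure_eq_measure2)
  have m: "0 < m" "m \<le> 1"
    using measure_mono_fmeasurable[OF E(2) E(1)] E(3) by (auto simp: m_def)
  have f0: "0 \<le> f t" if "f \<in> set fs" for f t using fs that by (auto simp: weak_type_def)
  have int: "(\<lambda>t. \<Sum>f\<leftarrow>fs. sqrt (f t)) \<in> borel_measurable lebesgue \<and>
      (\<integral>\<^sup>+t\<in>E. ennreal (\<Sum>f\<leftarrow>fs. sqrt (f t)) \<partial>lebesgue) \<le> ennreal (real (length fs) * (600 * sqrt m))"
    using fs
  proof (induction fs)
    case (Cons f fs)
    have f: "f \<in> borel_measurable lebesgue" "\<And>t. f t \<ge> 0"
        "(\<integral>\<^sup>+x\<in>E. ennreal (sqrt (f x)) \<partial>lebesgue) \<le> ennreal (600 * sqrt m)"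
      using Cons.prems E by (auto simp: weak_type_def m_def)
    note [measurable] = f(1)
    have pos: "0 \<le> (\<Sum>f\<leftarrow>fs. sqrt (f t))" for t
      using Cons.prems by (intro sum_list_nonneg) (auto simp: weak_type_def)
    have IH: "(\<lambda>t. \<Sum>f\<leftarrow>fs. sqrt (f t)) \<in> borel_measurable lebesgue"
      "(\<integral>\<^sup>+t\<in>E. ennreal (\<Sum>f\<leftarrow>fs. sqrt (f t)) \<partial>lebesgue) \<le> ennreal (real (length fs) * (600 * sqrt m))"
      using Cons by auto
    note [measurable] = IH(1)
    have "(\<integral>\<^sup>+t\<in>E. ennreal (\<Sum>f\<leftarrow>f # fs. sqrt (f t)) \<partial>lebesgue)
      = (\<integral>\<^sup>+t. ennreal (sqrt (f t)) * indicator E t + ennreal (\<Sum>f\<leftarrow>fs. sqrt (f t)) * indicator E t \<partial>lebesgue)"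
      using f(2) pos by (intro nn_integral_cong) (auto split: split_indicator)
    also have "\<dots> = (\<integral>\<^sup>+t\<in>E. ennreal (sqrt (f t)) \<partial>lebesgue) + (\<integral>\<^sup>+t\<in>E. ennreal (\<Sum>f\<leftarrow>fs. sqrt (f t)) \<partial>lebesgue)"
      by (rule nn_integral_add) measurable
    also have "\<dots> \<le> ennreal (600 * sqrt m) + ennreal (real (length fs) * (600 * sqrt m))"
      by (intro add_mono f IH)
    also have "\<dots> = ennreal (real (length (f # fs)) * (600 * sqrt m))"
      using m by (subst ennreal_plus[symmetric]) (auto simp: algebra_simps)
    finally show ?case using IH(1) f(1) by (auto intro!: borel_measurable_add)
  qed simp
  have nullZ: "Z \<in> null_sets lebesgue"
    using Z finite_imp_null_set_lborel null_sets_completionI by blast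
  have "\<exists>t\<in>E - Z. S t \<le> real d * (1200 / sqrt m)"
  proof (rule ccontr)
    assume "\<not> ?thesis"
    then have big: "real d * (1200 / sqrt m) < S t" if "t \<in> E - Z" for t using that by force
    \<comment> \<open>For an empty list the assumed strict inequality reads 0 < 0, so
      \<open>E\<close> would lie in the null set \<open>Z\<close>. A positive \<open>d\<close> is
      what makes the comparison of 1200 with 600 contradictory.\<close>
    have d: "d > 0"
    proof (rule ccontr)
      assume "\<not> d > 0"
      then have "t \<notin> E - Z" for t using big[of t] by (auto simp: S_def d_def)
      then have "E \<subseteq> Z" by auto
      then have "E \<in> null_sets lebesgue" using nullZ E(1) null_sets_subset by blast
      then show False using emE m by (simp add: null_sets_def)
    qed
    have "ennreal (real d * (1200 / sqrt m) * m) = ennreal (real d * (1200 / sqrt m)) * emeasure lebesgue E"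
      unfolding emE using m by (subst ennreal_mult'') auto
    also have "\<dots> = (\<integral>\<^sup>+t. ennreal (real d * (1200 / sqrt m)) * indicator E t \<partial>lebesgue)"
      by (rule nn_integral_cmult_indicator[OF E(1), symmetric])
    also have "\<dots> \<le> (\<integral>\<^sup>+t\<in>E. ennreal (S t) \<partial>lebesgue)"
    proof (rule nn_integral_mono_AE, use AE_not_in[OF nullZ] in eventually_elim)
      case (elim t)
      then show ?case using big[of t] by (cases "t \<in> E") (auto intro!: ennreal_leI)
    qed
    also have "\<dots> \<le> ennreal (real d * (600 * sqrt m))" using int by (simp add: S_def d_def)
    finally have "real d * (1200 / sqrt m) * m \<le> real d * (600 * sqrt m)"
      using m by (subst (asm) ennreal_le_iff) auto
    moreover have "real d * (1200 / sqrt m) * m = real d * (1200 * sqrt m)"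
      using m by (simp add: real_div_sqrt field_simps)
    ultimately show False using d m by simp
  qed
  then obtain t where t: "t \<in> E - Z" "S t \<le> real d * (1200 / sqrt m)" by blast
  \<comment> \<open>An upper bound for the mean of 1 + sqrt f, using sqrt |E| <= 1; its square is
    1442401 / |E|, below the stated 1500000 / |E|.\<close>
  define B where "B = 1201 / sqrt m"
  have sm: "0 < sqrt m" "sqrt m \<le> 1" using m by auto
  have "1 \<le> 1 / sqrt m" using sm by simp
  moreover have "1 / sqrt m + 1200 / sqrt m = 1201 / sqrt m" by (simp flip: add_divide_distrib)
  ultimately have "1 + 1200 / sqrt m \<le> 1201 / sqrt m" by linarith
  then have B: "B > 0" "1 + 1200 / sqrt m \<le> B" using sm by (simp_all add: B_def)
  \<comment> \<open>arithmetic-geometric mean inequality, via \<open>1 + x \<le> B exp ((1 + x) / B - 1)\<close>\<close>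
  have "(\<Prod>f\<leftarrow>fs. 1 + f t) \<le> (B ^ length fs * exp ((\<Sum>f\<leftarrow>fs. (1 + sqrt (f t)) / B - 1)))\<^sup>2"
    using f0
  proof (induction fs)
    case (Cons f fs)
    have nn: "0 \<le> f t" using Cons.prems by auto
    have "1 + f t \<le> (1 + sqrt (f t))\<^sup>2" using nn by (simp add: power2_eq_square algebra_simps)
    also have "\<dots> \<le> (B * exp ((1 + sqrt (f t)) / B - 1))\<^sup>2"
    proof (rule power_mono)
      have "(1 + sqrt (f t)) / B \<le> exp ((1 + sqrt (f t)) / B - 1)"
        using exp_ge_add_one_self[of "(1 + sqrt (f t)) / B - 1"] by simp
      then show "1 + sqrt (f t) \<le> B * exp ((1 + sqrt (f t)) / B - 1)"
        using B(1) by (simp add: field_simps)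
    qed (use nn in auto)
    finally have "(1 + f t) * (\<Prod>f\<leftarrow>fs. 1 + f t) \<le> (B * exp ((1 + sqrt (f t)) / B - 1))\<^sup>2 * (B ^ length fs * exp ((\<Sum>f\<leftarrow>fs. (1 + sqrt (f t)) / B - 1)))\<^sup>2"
      using Cons prod_list_one_plus_ge_1[of fs "\<lambda>f. f t"] by (intro mult_mono) (auto intro: order_trans[OF zero_le_one])
    also have "\<dots> = (B ^ length (f # fs) * exp ((\<Sum>f\<leftarrow>f # fs. (1 + sqrt (f t)) / B - 1)))\<^sup>2"
      by (simp add: power_mult_distrib[symmetric] exp_add mult_ac)
    finally show ?case by simp
  qed simp
  also have "\<dots> \<le> (B ^ length fs * 1)\<^sup>2"
  proof (intro power_mono mult_left_mono)
    have "(\<Sum>f\<leftarrow>fs. (1 + sqrt (f t)) / B - 1) = (real d + S t) / B - real d"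
      unfolding S_def d_def by (induction fs) (auto simp: add_divide_distrib)
    also have "\<dots> \<le> 0"
    proof -
      have "real d + S t \<le> real d * (1 + 1200 / sqrt m)" using t(2) by (simp add: algebra_simps)
      also have "\<dots> \<le> real d * B" using B(2) by (intro mult_left_mono) auto
      finally show ?thesis using B(1) by (simp add: field_simps)
    qed
    finally show "exp (\<Sum>f\<leftarrow>fs. (1 + sqrt (f t)) / B - 1) \<le> 1" by simp
  qed (use B in auto)
  also have "\<dots> = (B\<^sup>2) ^ length fs" by (simp add: power_mult[symmetric] mult.commute)
  also have "\<dots> \<le> (1500000 / m) ^ length fs"
    using m by (intro power_mono) (auto simp: B_def power_divide intro!: divide_right_mono)
  finally show ?thesis using t(1) unfolding m_def by blast
qed

text \<open>The chain is evaluated at the good point. The conclusion names a point of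
  \<open>E\<close> instead of a supremum, so that a null set can later be removed from
  \<open>E\<close> to reach the essential supremum.\<close>

lemma turan_nazarov_unit_interval:
  assumes L: "finite L" "L \<noteq> {}" and c: "\<And>\<mu>. \<mu> \<in> L \<Longrightarrow> c \<mu> \<noteq> 0"
    and M: "\<And>\<mu>. \<mu> \<in> L \<Longrightarrow> \<bar>Re \<mu>\<bar> \<le> M"
    and E: "E \<in> sets lebesgue" "E \<subseteq> {0..1}" "measure lebesgue E > 0"
  shows "\<exists>t0\<in>E. \<forall>t\<in>{0..1}. cmod (ep L c (of_real t)) \<le>
      exp M * (10000000 / measure lebesgue E) ^ (card L - 1) * cmod (ep L c (of_real t0))"
proof (cases "card L = 1")
  case True
  then obtain \<mu> where \<mu>: "L = {\<mu>}" by (auto simp: card_1_singleton_iff)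
  from E(3) have "E \<noteq> {}" by auto
  then obtain t0 where t0: "t0 \<in> E" "t0 \<in> {0..1}" using E(2) by blast
  have "cmod (ep L c (of_real t)) \<le> exp M * cmod (ep L c (of_real t0))" if "t \<in> {0..1}" for t
  proof -
    have "Re \<mu> * (t - t0) \<le> \<bar>Re \<mu>\<bar> * \<bar>t - t0\<bar>" by (simp flip: abs_mult)
    also have "\<dots> \<le> M * 1" using M[of \<mu>] \<mu> that t0(2) by (intro mult_mono) auto
    finally have "exp (Re \<mu> * t) \<le> exp (M + Re \<mu> * t0)" by (simp add: algebra_simps)
    then show ?thesis
      by (simp add: \<mu> ep_def norm_mult exp_add mult.left_commute[of "exp M"] mult_left_mono)
  qed
  then show ?thesis using t0(1) True by (intro bexI[of _ t0]) auto
next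
  case False
  \<comment> \<open>This takes the role of \<open>N\<close> in the chain: for at least two exponents
    it is positive and the order is at most \<open>2 * d\<close>. A single exponent would give 0 and
    is settled directly above.\<close>
  define d where "d = card L - 1"
  have card: "card L \<ge> 2" using False L by (metis One_nat_def Suc_leI card_gt_0_iff le_neq_implies_less numeral_2_eq_2)
  then have d: "real d > 0" "real (card L) \<le> 2 * real d" by (auto simp: d_def)
  have "\<exists>fs Z. length fs = d \<and> (\<forall>f\<in>set fs. weak_type f) \<and> finite Z \<and>
    (\<forall>t\<in>{0..1}. \<forall>t0\<in>{0..1} - Z. cmod (ep L c (of_real t)) \<le>
        2 ^ d * exp (M + real d) * (\<Prod>f\<leftarrow>fs. 1 + f t0) * cmod (ep L c (of_real t0)))"
    unfolding d_def by (rule ep_chain) (use L c M d in \<open>auto simp: d_def\<close>)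
  then obtain fs Z where fs: "length fs = d" "\<forall>f\<in>set fs. weak_type f" "finite Z"
    and ch: "\<And>t t0. t \<in> {0..1} \<Longrightarrow> t0 \<in> {0..1} - Z \<Longrightarrow> cmod (ep L c (of_real t)) \<le>
        2 ^ d * exp (M + real d) * (\<Prod>f\<leftarrow>fs. 1 + f t0) * cmod (ep L c (of_real t0))"
    by blast
  obtain t0 where t0: "t0 \<in> E - Z" "(\<Prod>f\<leftarrow>fs. 1 + f t0) \<le> (1500000 / measure lebesgue E) ^ d"
    using weak_type_point[OF fs(2,3) E] fs(1) by auto
  have "2 ^ d * exp (M + real d) * (\<Prod>f\<leftarrow>fs. 1 + f t0)
    \<le> 2 ^ d * exp (M + real d) * (1500000 / measure lebesgue E) ^ d"
    using t0(2) by (intro mult_left_mono) auto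
  \<comment> \<open>Only exp M stays outside; 2^d and exp d enter the d-th power, with 2 * 3 *
    1500000 = 9000000 below the final constant.\<close>
  also have "\<dots> = exp M * (2 * exp 1 * (1500000 / measure lebesgue E)) ^ d"
    unfolding power_mult_distrib exp_add exp_of_nat_mult[of d 1, simplified] by (simp only: mult_ac)
  also have "\<dots> \<le> exp M * (10000000 / measure lebesgue E) ^ d"
  proof (intro mult_left_mono power_mono)
    have "2 * exp 1 * 1500000 / measure lebesgue E \<le> 10000000 / measure lebesgue E"
      using exp_le E(3) by (intro divide_right_mono) auto
    then show "2 * exp 1 * (1500000 / measure lebesgue E) \<le> 10000000 / measure lebesgue E" by simp
  qed (use E(3) in auto)
  finally have K: "2 ^ d * exp (M + real d) * (\<Prod>f\<leftarrow>fs. 1 + f t0) \<le> exp M * (10000000 / measure lebesgue E) ^ d" .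
  have "cmod (ep L c (of_real t)) \<le> exp M * (10000000 / measure lebesgue E) ^ d * cmod (ep L c (of_real t0))"
    if "t \<in> {0..1}" for t
    using ch[OF that, of t0] t0(1) E(2) mult_right_mono[OF K norm_ge_zero[of "ep L c (of_real t0)"]] by fastforce
  then show ?thesis using t0(1) unfolding d_def by blast
qed

section \<open>Arbitrary intervals and the essential supremum\<close>

text \<open>The substitution t = a + h s multiplies the exponents by \<open>h\<close>, puts the
  factors exp(\<mu> a) into the coefficients, and divides the measure of the set by
  \<open>h\<close>.\<close>

lemma turan_nazarov_interval:
  assumes L: "finite L" "L \<noteq> {}" and c: "\<And>\<mu>. \<mu> \<in> L \<Longrightarrow> c \<mu> \<noteq> 0"
    and M: "\<And>\<mu>. \<mu> \<in> L \<Longrightarrow> \<bar>Re \<mu>\<bar> \<le> M" and h: "h > 0"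
    and E: "E \<in> sets lebesgue" "E \<subseteq> {a..a + h}" "measure lebesgue E > 0"
  shows "\<exists>t0\<in>E. \<forall>t\<in>{a..a + h}. cmod (ep L c (of_real t)) \<le>
      exp (h * M) * (10000000 * h / measure lebesgue E) ^ (card L - 1) * cmod (ep L c (of_real t0))"
proof -
  define E' where "E' = (\<lambda>x. (1 / h) *\<^sub>R x + (- a / h)) ` E"
  define L' where "L' = (\<lambda>\<mu>. \<mu> * of_real h) ` L"
  define c' where "c' \<mu> = c (\<mu> / of_real h) * exp (\<mu> / of_real h * of_real a)" for \<mu>
  have inj: "inj_on (\<lambda>\<mu>. \<mu> * complex_of_real h) L" using h by (auto simp: inj_on_def)
  have ep': "ep L' c' (of_real s) = ep L c (of_real (a + h * s))" for s
    unfolding ep_def L'_def sum.reindex[OF inj] o_def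
    using h by (intro sum.cong) (auto simp: c'_def mult_exp_exp algebra_simps)
  have mE': "measure lebesgue E' = measure lebesgue E / h"
    unfolding E'_def measure_lebesgue_affine using h by simp
  have sE': "E' \<in> sets lebesgue"
  proof -
    have "(\<lambda>x. a + h * x) \<in> lebesgue \<rightarrow>\<^sub>M lebesgue"
      using lebesgue_affine_measurable[of "\<lambda>_. h" a] h by simp
    from measurable_sets[OF this E(1)] have "(\<lambda>x. a + h * x) -` E \<in> sets lebesgue" by simp
    moreover have "E' = (\<lambda>x. a + h * x) -` E"
      using h by (force simp: E'_def image_iff field_simps)
    ultimately show ?thesis by simp
  qed
  have subE': "E' \<subseteq> {0..1}"
  proof
    fix y assume "y \<in> E'"
    then obtain x where "x \<in> E" "y = (x - a) / h" by (auto simp: E'_def diff_divide_distrib)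
    moreover from this have "a \<le> x" "x \<le> a + h" using E(2) by auto
    ultimately show "y \<in> {0..1}" using h by simp
  qed
  have "\<exists>t0\<in>E'. \<forall>t\<in>{0..1}. cmod (ep L' c' (of_real t)) \<le>
      exp (h * M) * (10000000 / measure lebesgue E') ^ (card L' - 1) * cmod (ep L' c' (of_real t0))"
  proof (rule turan_nazarov_unit_interval)
    show "\<bar>Re \<mu>\<bar> \<le> h * M" if "\<mu> \<in> L'" for \<mu>
      using that M h by (auto simp: L'_def abs_mult mult.commute[of h] intro!: mult_right_mono)
    show "c' \<mu> \<noteq> 0" if "\<mu> \<in> L'" for \<mu> using that c h by (auto simp: L'_def c'_def)
    show "measure lebesgue E' > 0" using E(3) h by (simp add: mE')
  qed (use L sE' subE' in \<open>auto simp: L'_def\<close>)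
  then obtain s0 where s0: "s0 \<in> E'" and le: "\<And>s. s \<in> {0..1} \<Longrightarrow> cmod (ep L' c' (of_real s)) \<le>
      exp (h * M) * (10000000 * h / measure lebesgue E) ^ (card L - 1) * cmod (ep L' c' (of_real s0))"
    using card_image[OF inj] by (auto simp: mE' L'_def)
  from s0 obtain t0 where t0: "t0 \<in> E" "s0 = t0 / h - a / h" by (auto simp: E'_def)
  have "a + h * s0 = t0" using t0(2) h by (simp add: right_diff_distrib)
  moreover have "a + h * ((t - a) / h) = t" "(t - a) / h \<in> {0..1}" if "t \<in> {a..a + h}" for t
    using that h by auto
  ultimately have "cmod (ep L c (of_real t)) \<le>
      exp (h * M) * (10000000 * h / measure lebesgue E) ^ (card L - 1) * cmod (ep L c (of_real t0))" if "t \<in> {a..a + h}" for t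
    using le[of "(t - a) / h"] that unfolding ep' by metis
  with t0(1) show ?thesis by blast
qed

text \<open>The interval may lack its endpoints, but it contains the open interval between its
  infimum and supremum; the closed hull is therefore no longer than its measure.\<close>

lemma bounded_interval_subset:
  fixes I :: "real set"
  assumes "is_interval I" "bounded I" "measure lebesgue I > 0"
  obtains a where "I \<subseteq> {a..a + measure lebesgue I}"
proof -
  define a b where "a = Inf I" and "b = Sup I"
  have ne: "I \<noteq> {}" using assms(3) by auto
  have bdd: "bdd_below I" "bdd_above I"
    using assms(2) bounded_imp_bdd_below bounded_imp_bdd_above by auto
  have sub: "I \<subseteq> {a..b}"
    using bdd by (auto simp: a_def b_def intro: cInf_lower cSup_upper)
  have "{a<..<b} \<subseteq> I"
  proof
    fix x assume "x \<in> {a<..<b}"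
    then obtain y z where "y \<in> I" "y < x" "z \<in> I" "x < z"
      using bdd ne unfolding a_def b_def by (auto simp: cInf_less_iff less_cSup_iff)
    then show "x \<in> I" using assms(1) by (meson is_interval_1 less_imp_le)
  qed
  moreover have lm: "I \<in> lmeasurable"
    using assms by (intro measurable_convex) (auto simp: is_interval_convex_1)
  ultimately have "measure lebesgue {a<..<b} \<le> measure lebesgue I"
    by (intro measure_mono_fmeasurable) auto
  moreover have "a \<le> b" using ne sub by auto
  ultimately have "b \<le> a + measure lebesgue I" by simp
  then show thesis using sub by (intro that[of a]) auto
qed

theorem corollary1p3:
  shows "\<exists>C::real. C > 0 \<and>
    (\<forall>(m::nat) (c::nat \<Rightarrow> complex) (l::nat \<Rightarrow> complex) (p::real \<Rightarrow> complex) (I::real set) (E::real set).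
       m \<ge> 1 \<longrightarrow>
       p = (\<lambda>t. \<Sum>j=1..m. c j * exp (l j * of_real t)) \<longrightarrow>
       exp_order p \<le> m \<longrightarrow>
       is_interval I \<longrightarrow> bounded I \<longrightarrow>
       E \<subseteq> I \<longrightarrow> E \<in> sets lebesgue \<longrightarrow> measure lebesgue E > 0 \<longrightarrow>
       (p = (\<lambda>t. 0) \<longrightarrow>
          (SUP t\<in>I. ereal (cmod (p t))) = 0 \<and>
          esssup (lebesgue_on E) (\<lambda>t. ereal (cmod (p t))) = 0) \<and>
       (p \<noteq> (\<lambda>t. 0) \<longrightarrow>
          (SUP t\<in>I. ereal (cmod (p t)))
            \<le> ereal (exp (measure lebesgue I * (MAX \<mu>\<in>exp_spec p. \<bar>Re \<mu>\<bar>))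
                     * (C * measure lebesgue I / measure lebesgue E) ^ (m - 1))
              * esssup (lebesgue_on E) (\<lambda>t. ereal (cmod (p t)))))"
proof (intro exI[of _ "10000000::real"] conjI allI impI)
  fix m :: nat and c l :: "nat \<Rightarrow> complex" and p :: "real \<Rightarrow> complex" and I E :: "real set"
  assume m: "m \<ge> 1" and p: "p = (\<lambda>t. \<Sum>j=1..m. c j * exp (l j * of_real t))"
    and ord: "exp_order p \<le> m" and I: "is_interval I" "bounded I"
    and E: "E \<subseteq> I" "E \<in> sets lebesgue" "measure lebesgue E > 0"
  \<comment> \<open>For the zero function, nonempty \<open>I\<close> and non-null \<open>E\<close>
    keep the supremum and the essential supremum at 0 instead of minus infinity.\<close>
  have "I \<noteq> {}" using E(1,3) by auto
  have emE: "emeasure lebesgue E \<noteq> 0" using E(3) by (auto simp: measure_def)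
  {
    assume "p = (\<lambda>t. 0)"
    then show "(SUP t\<in>I. ereal (cmod (p t))) = 0"
      using \<open>I \<noteq> {}\<close> by (simp add: zero_ereal_def)
    have "emeasure (lebesgue_on E) (space (lebesgue_on E)) \<noteq> 0"
      using emE E(2) by (simp add: emeasure_restrict_space)
    then show "esssup (lebesgue_on E) (\<lambda>t. ereal (cmod (p t))) = 0"
      using \<open>p = (\<lambda>t. 0)\<close> by (simp add: esssup_const zero_ereal_def)
  }
  assume p0: "p \<noteq> (\<lambda>t. 0)"
  define S where "S = esssup (lebesgue_on E) (\<lambda>t. ereal (cmod (p t)))"
  define L where "L = exp_spec p"
  have "is_exp_poly p" unfolding p by (rule is_exp_poly_sum)
  then obtain L0 a where "reduced_exp_poly L0 a p" by (auto simp: is_exp_poly_def)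
  then have red: "reduced_exp_poly L a p" using exp_spec_eq unfolding L_def by simp
  have L: "finite L" "\<And>\<mu>. \<mu> \<in> L \<Longrightarrow> a \<mu> \<noteq> 0" and pe: "p t = ep L a (of_real t)" for t
    using red by (auto simp: reduced_exp_poly_def ep_def)
  have Lne: "L \<noteq> {}" using p0 pe by (auto simp: ep_def)
  have cardL: "card L \<le> m" using ord by (simp add: exp_order_def L_def)
  define M where "M = (MAX \<mu>\<in>L. \<bar>Re \<mu>\<bar>)"
  have M: "\<bar>Re \<mu>\<bar> \<le> M" if "\<mu> \<in> L" for \<mu> using L(1) that by (auto simp: M_def)
  define h where "h = measure lebesgue I"
  have lI: "I \<in> lmeasurable"
    using I by (intro measurable_convex) (auto simp: is_interval_convex_1)
  have Eh: "measure lebesgue E \<le> h" unfolding h_def using E lI by (intro measure_mono_fmeasurable) auto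
  then have h: "h > 0" using E(3) by simp
  obtain b where b: "I \<subseteq> {b..b + h}"
    using bounded_interval_subset[OF I] h unfolding h_def by blast
  have "AE t in lebesgue_on E. ereal (cmod (p t)) \<le> S" unfolding S_def by (rule esssup_AE)
  then have "AE t in lebesgue. t \<in> E \<longrightarrow> ereal (cmod (p t)) \<le> S"
    using E(2) by (simp add: AE_restrict_space_iff)
  then obtain N where N: "N \<in> null_sets lebesgue" and NS: "\<And>t. t \<in> E - N \<Longrightarrow> ereal (cmod (p t)) \<le> S"
    by (auto elim!: AE_E3)
  \<comment> \<open>Deleting the null set where |p| exceeds its essential supremum leaves the
    measure unchanged, so the point produced from \<open>E - N\<close> satisfies |p(t0)| <=
    \<open>S\<close>.\<close>
  have mEN: "measure lebesgue (E - N) = measure lebesgue E"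
    using N E(2) by (simp add: measure_Diff_null_set)
  have "\<exists>t0\<in>E - N. \<forall>t\<in>{b..b + h}. cmod (ep L a (of_real t)) \<le>
      exp (h * M) * (10000000 * h / measure lebesgue (E - N)) ^ (card L - 1) * cmod (ep L a (of_real t0))"
    by (rule turan_nazarov_interval) (use L Lne M h E b N mEN in auto)
  then obtain t0 where t0: "t0 \<in> E - N" and le: "\<And>t. t \<in> I \<Longrightarrow> cmod (p t) \<le>
      exp (h * M) * (10000000 * h / measure lebesgue E) ^ (card L - 1) * cmod (p t0)"
    using b by (auto simp: mEN pe)
  \<comment> \<open>As |E| <= |I|, the base is at least 1 and the exponent can be raised from the
    order minus one to m - 1.\<close>
  have base: "1 \<le> 10000000 * h / measure lebesgue E" using Eh E(3) h by (simp add: field_simps)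
  define K where "K = exp (h * M) * (10000000 * h / measure lebesgue E) ^ (m - 1)"
  have K0: "K \<ge> 0" using base by (simp add: K_def)
  have "cmod (p t) \<le> K * cmod (p t0)" if "t \<in> I" for t
  proof -
    have "(10000000 * h / measure lebesgue E) ^ (card L - 1) \<le> (10000000 * h / measure lebesgue E) ^ (m - 1)"
      using cardL by (intro power_increasing[OF _ base]) auto
    then have "exp (h * M) * (10000000 * h / measure lebesgue E) ^ (card L - 1) * cmod (p t0) \<le> K * cmod (p t0)"
      unfolding K_def by (intro mult_right_mono mult_left_mono) auto
    with le[OF that] show ?thesis by linarith
  qed
  then have "(SUP t\<in>I. ereal (cmod (p t))) \<le> ereal K * ereal (cmod (p t0))"
    by (intro SUP_least) simp
  also have "\<dots> \<le> ereal K * S"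
    using K0 NS[OF t0] by (intro ereal_mult_left_mono) auto
  finally show "(SUP t\<in>I. ereal (cmod (p t)))
      \<le> ereal (exp (measure lebesgue I * (MAX \<mu>\<in>exp_spec p. \<bar>Re \<mu>\<bar>))
               * (10000000 * measure lebesgue I / measure lebesgue E) ^ (m - 1))
        * esssup (lebesgue_on E) (\<lambda>t. ereal (cmod (p t)))"
    unfolding K_def S_def h_def M_def L_def .
qed simp

end
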